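(* Let $f$ be a transcendental entire function. If $f$ has a finite logarithmic asymptotic value $\alpha\in J(f)$, then $BU(f)\cup\{\infty\}$ is a connected subset of the Riemann sphere.
   Context: For an entire function $f$, $f^n$ denotes its $n$-th iterate; $J(f)$ is the Julia set (points in no neighbourhood of which $(f^n)$ is normal). The escaping set is $I(f) := \{z : f^n(z)\to\infty\}$, the bounded orbit set is $BO(f) := \{z : \exists K>0,\ |f^n(z)|<K \ \forall n\ge0\}$, and the bungee set is $BU(f) := \mathbb{C}\setminus(I(f)\cup BO(f))$. Write $B(a,r)=\{z:|z-a|<r\}$. A value $\alpha\in\mathbb{C}$ is a finite logarithmic asymptotic value of $f$ if there exist $r>0$ and a component $U$ of $f^{-1}(B(\alpha,r))$ such that the restriction $f: U\to B(\alpha,r)\setminus\{\alpha\}$ is a universal covering. *)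

theory Defs
  imports "HOL-Complex_Analysis.Complex_Analysis" "HOL-Computational_Algebra.Polynomial"
begin

definition transcendental_entire :: "(complex \<Rightarrow> complex) \<Rightarrow> bool" where
  "transcendental_entire f \<longleftrightarrow> f holomorphic_on UNIV \<and> \<not> (\<exists>p. \<forall>z. f z = poly p z)"

definition normal_family_on :: "(complex \<Rightarrow> complex) set \<Rightarrow> complex set \<Rightarrow> bool" where
  "normal_family_on F S \<longleftrightarrow>
     (\<forall>g :: nat \<Rightarrow> complex \<Rightarrow> complex. (\<forall>n. g n \<in> F) \<longrightarrow>
        (\<exists>r. strict_mono r \<and>
          ((\<exists>h. \<forall>K. K \<subseteq> S \<and> compact K \<longrightarrow> uniform_limit K (\<lambda>n. g (r n)) h sequentially)
           \<or> (\<forall>K. K \<subseteq> S \<and> compact K \<longrightarrow>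
                (\<forall>B. \<forall>\<^sub>F n in sequentially. \<forall>z\<in>K. B \<le> norm (g (r n) z))))))"

definition fatou_set :: "(complex \<Rightarrow> complex) \<Rightarrow> complex set" where
  "fatou_set f = {z. \<exists>U. open U \<and> z \<in> U \<and> normal_family_on (range (\<lambda>n. f ^^ n)) U}"

definition julia_set :: "(complex \<Rightarrow> complex) \<Rightarrow> complex set" where
  "julia_set f = - fatou_set f"

definition escaping_set :: "(complex \<Rightarrow> complex) \<Rightarrow> complex set" where
  "escaping_set f = {z. filterlim (\<lambda>n. (f ^^ n) z) at_infinity sequentially}"

definition bounded_orbit_set :: "(complex \<Rightarrow> complex) \<Rightarrow> complex set" where
  "bounded_orbit_set f = {z. \<exists>K>0. \<forall>n. norm ((f ^^ n) z) < K}"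

definition bungee_set :: "(complex \<Rightarrow> complex) \<Rightarrow> complex set" where
  "bungee_set f = - (escaping_set f \<union> bounded_orbit_set f)"

definition finite_log_asymptotic_value :: "(complex \<Rightarrow> complex) \<Rightarrow> complex \<Rightarrow> bool" where
  "finite_log_asymptotic_value f \<alpha> \<longleftrightarrow>
     (\<exists>r>0. \<exists>U. U \<in> components (f -` ball \<alpha> r) \<and> simply_connected U \<and>
        covering_space U f (ball \<alpha> r - {\<alpha>}))"

text \<open>Riemann sphere, realised as the unit sphere in complex x real via inverse
  stereographic projection; infinity corresponds to the north pole (0,1).\<close>
definition sphere_of :: "complex \<Rightarrow> complex \<times> real" where
  "sphere_of z = (of_real (2 / (1 + (cmod z)\<^sup>2)) * z, ((cmod z)\<^sup>2 - 1) / ((cmod z)\<^sup>2 + 1))"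

definition sphere_infinity :: "complex \<times> real" where
  "sphere_infinity = (0, 1)"

end

theory Submission
  imports Defs
begin

text \<open>If \<open>BU(f) \<union> {\<infinity>}\<close> were disconnected, there would be a bounded open set \<open>G\<close> meeting
  \<open>BU(f)\<close> whose frontier misses it.

  If \<open>G\<close> meets \<open>J(f)\<close>, then by Montel some iterate of \<open>G\<close>, with its holes filled, contains a large disc,
  and the outer frontier of that iterate must cross the tract over \<open>\<alpha>\<close>. Because \<open>f\<close> omits \<open>\<alpha>\<close> on the closure
  of the tract, the image of this frontier separates \<open>\<alpha>\<close> from the circle of radius \<open>r/2\<close>, hence contains the
  frontier of a domain around \<open>\<alpha> \<in> J(f)\<close>. Repeating this, nested compact sets give a point of the frontier of \<open>G\<close>
  whose orbit is alternately very large and close to \<open>\<alpha>\<close>.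

  Otherwise a component of \<open>G\<close> is a bounded wandering domain in \<open>BU(f)\<close> with frontier in \<open>J(f)\<close>. The first
  argument also shows that no continuum in the Fatou set encloses a Julia point, so this component is simply
  connected and \<open>J(f)\<close> contains continua joining large circles. Harmonic measure then sees a bungee point on
  the frontier: the omitted disc around a base point keeps the bounded iterates bounded with probability at
  least 3/4, and a square root branch on the complement of a Julia continuum keeps the large iterates large with
  probability close to 1.\<close>

section \<open>Normality\<close>

text \<open>The blow-up argument needs an open set meeting \<open>julia_set f\<close>. For a
  wandering domain only the frontier lies there, and blowing up a neighbourhood of a frontier point
  would yield a bungee point on the frontier of that neighbourhood, not on the given one. Harmonic
  measure is the substitute: it carries estimates from an interior point \<open>z0\<close>, whose
  orbit oscillates, to boundary points. Each estimate needs a zero-free \<open>g\<close> bounded by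
  1 on the domain, not too small at \<open>z0\<close> and very small on the bad set. At times when
  \<open>z0\<close> has a bounded image, \<open>g\<close> is a multiple of the reciprocal of
  \<open>f ^^ n - z0\<close>, which is bounded because later images avoid the domain itself. At
  times when the image of \<open>z0\<close> is large, the bad set is where \<open>f ^^ n\<close> is
  moderate, and there the reciprocal is not small; a quotient vanishing only at \<open>z0\<close> is
  composed with \<open>f ^^ n\<close> instead. The bad events have measure at most 1/4 for the first
  kind and at most the sum of \<open>(1/2) ^ (k + 3)\<close>, again 1/4, for the second, so some
  boundary point avoids them all.\<close>

lemma infinite_set_subsequence:
  fixes P :: "nat \<Rightarrow> bool"
  assumes "infinite {n. P n}"
  obtains s :: "nat \<Rightarrow> nat" where "strict_mono s" "\<And>n. P (s n)"
  using infinite_enumerate[OF assms] by auto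

text \<open>Montel's fundamental normality test. Schottky's bound \<open>GPicard3\<close> gives
  local boundedness once the values at one base point are bounded by 1. If this holds for only
  finitely many \<open>n\<close>, the reciprocals, which also omit 0 and 1, satisfy it infinitely
  often; by Hurwitz their limit is zero-free, or identically 0 and the functions diverge.\<close>

lemma omitting_01_subsequence:
  fixes h :: "nat \<Rightarrow> complex \<Rightarrow> complex"
  assumes S: "open S" "connected S"
    and hol: "\<And>n. h n holomorphic_on S"
    and omit: "\<And>n z. z \<in> S \<Longrightarrow> h n z \<noteq> 0 \<and> h n z \<noteq> 1"
  shows "\<exists>r. strict_mono r \<and>
          ((\<exists>g. \<forall>K. K \<subseteq> S \<and> compact K \<longrightarrow> uniform_limit K (\<lambda>n. h (r n)) g sequentially)
           \<or> (\<forall>K. K \<subseteq> S \<and> compact K \<longrightarrow>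
                (\<forall>B. \<forall>\<^sub>F n in sequentially. \<forall>z\<in>K. B \<le> norm (h (r n) z))))"
proof (cases "S = {}")
  case True
  then show ?thesis by (auto intro!: exI[of _ id] simp: strict_mono_id)
next
  case False
  then obtain w where w: "w \<in> S" by auto
  have key: "\<exists>g r. g holomorphic_on S \<and> strict_mono (r::nat\<Rightarrow>nat) \<and>
       (\<forall>K. compact K \<and> K \<subseteq> S \<longrightarrow> uniform_limit K (\<lambda>n. F (r n)) g sequentially)"
    if F: "\<And>n. F n holomorphic_on S" "\<And>n z. z \<in> S \<Longrightarrow> F n z \<noteq> 0 \<and> F n z \<noteq> 1"
      "\<And>n. norm (F n w) \<le> 1" for F :: "nat \<Rightarrow> complex \<Rightarrow> complex"
  proof -
    have bd: "\<exists>B. \<forall>u \<in> range F. \<forall>z \<in> K. norm (u z) \<le> B" if K: "compact K" "K \<subseteq> S" for K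
    proof -
      obtain B where "\<And>u z. \<lbrakk>u \<in> range F; z \<in> K\<rbrakk> \<Longrightarrow> norm (u z) \<le> B"
        by (rule GPicard3[OF S w, of "range F" "range F" K]) (use F K in auto)
      then show ?thesis by blast
    qed
    obtain g r where "g holomorphic_on S" "strict_mono (r::nat\<Rightarrow>nat)"
      "\<And>K. \<lbrakk>compact K; K \<subseteq> S\<rbrakk> \<Longrightarrow> uniform_limit K (F \<circ> r) g sequentially"
    proof (rule Montel[OF S(1), of "range F" F])
      show "h holomorphic_on S" if "h \<in> range F" for h using F(1) that by blast
      show "\<exists>B. \<forall>h\<in>range F. \<forall>z\<in>K. norm (h z) \<le> B" if "compact K" "K \<subseteq> S" for K
        using bd that by blast
    qed blast+
    then show ?thesis unfolding o_def by blast
  qed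
  show ?thesis
  proof (cases "infinite {n. norm (h n w) \<le> 1}")
    case True
    from infinite_set_subsequence[OF this]
    obtain s where s: "strict_mono (s::nat\<Rightarrow>nat)" "\<And>n. norm (h (s n) w) \<le> 1" by blast
    obtain g r where "strict_mono (r::nat\<Rightarrow>nat)"
      "\<forall>K. compact K \<and> K \<subseteq> S \<longrightarrow> uniform_limit K (\<lambda>n. h (s (r n))) g sequentially"
      using key[of "\<lambda>n. h (s n)"] hol omit s(2) by blast
    then show ?thesis
      using s(1) by (intro exI[of _ "s \<circ> r"]) (auto simp: strict_mono_def o_def)
  next
    case False
    then have "infinite {n. norm (inverse (h n w)) \<le> 1}"
    proof -
      have "{n. norm (h n w) \<le> 1} \<union> {n. norm (inverse (h n w)) \<le> 1} = UNIV"
        by (auto simp: norm_inverse inverse_le_1_iff)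
      then show ?thesis using False by (metis finite_Un infinite_UNIV_nat)
    qed
    from infinite_set_subsequence[OF this]
    obtain s where s: "strict_mono (s::nat\<Rightarrow>nat)" "\<And>n. norm (inverse (h (s n) w)) \<le> 1" by blast
    define F where "F = (\<lambda>n z. inverse (h (s n) z))"
    have Fh: "F n holomorphic_on S" for n
      unfolding F_def using hol omit by (intro holomorphic_intros) auto
    have Fo: "z \<in> S \<Longrightarrow> F n z \<noteq> 0 \<and> F n z \<noteq> 1" for n z
      unfolding F_def using omit by (auto simp: inverse_eq_1_iff)
    have Fw: "norm (F n w) \<le> 1" for n using s(2) by (simp add: F_def)
    from key[of F, OF Fh Fo Fw] obtain g r where g: "g holomorphic_on S" and r: "strict_mono (r::nat\<Rightarrow>nat)"
      and ul: "\<And>K. compact K \<Longrightarrow> K \<subseteq> S \<Longrightarrow> uniform_limit K (\<lambda>n. F (r n)) g sequentially"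
      by blast
    show ?thesis
    proof (cases "\<exists>z\<in>S. g z = 0")
      case True
      then obtain z where z: "z \<in> S" "g z = 0" by auto
      have "g constant_on S"
        using Hurwitz_no_zeros[OF S, of "\<lambda>n. F (r n)" g z] Fh g ul Fo z by blast
      then have g0: "\<And>x. x \<in> S \<Longrightarrow> g x = 0" using z by (auto simp: constant_on_def)
      have "\<forall>\<^sub>F n in sequentially. \<forall>z\<in>K. B \<le> norm (h (s (r n)) z)" if "K \<subseteq> S" "compact K" for K B
      proof -
        have "\<forall>\<^sub>F n in sequentially. \<forall>z\<in>K. dist (F (r n) z) (g z) < 1 / (\<bar>B\<bar> + 1)"
          using ul[OF that(2,1)] by (intro uniform_limitD) auto
        then show ?thesis
        proof eventually_elim
          case (elim n)
          show ?case
          proof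
            fix z assume z: "z \<in> K"
            then have "norm (inverse (h (s (r n)) z)) < 1 / (\<bar>B\<bar> + 1)"
              using elim g0 that by (force simp: F_def)
            then show "B \<le> norm (h (s (r n)) z)"
              using omit[of z "s (r n)"] that z
                less_imp_inverse_less[of "norm (inverse (h (s (r n)) z))" "1 / (\<bar>B\<bar> + 1)"]
              by (auto simp: norm_inverse)
          qed
        qed
      qed
      moreover have "strict_mono (\<lambda>n. s (r n))" using s(1) r by (simp add: strict_mono_def)
      ultimately show ?thesis by (intro exI[of _ "\<lambda>n. s (r n)"]) blast
    next
      case nz: False
      have "uniform_limit K (\<lambda>n. h (s (r n))) (\<lambda>z. inverse (g z)) sequentially" if KK: "K \<subseteq> S" "compact K" for K
      proof (cases "K = {}")
        case False
        have cont: "continuous_on K (\<lambda>z. norm (g z))"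
          using g KK by (intro continuous_intros) (meson holomorphic_on_imp_continuous_on holomorphic_on_subset)
        obtain x where x: "x \<in> K" "\<And>y. y \<in> K \<Longrightarrow> norm (g x) \<le> norm (g y)"
          using continuous_attains_inf[OF KK(2) False cont] by blast
        have "uniform_limit K (\<lambda>n z. inverse (F (r n) z)) (\<lambda>z. inverse (g z)) sequentially"
          by (rule uniform_lim_inverse[OF ul[OF KK(2,1)], of "norm (g x)", unfolded o_def]) (use x nz KK in auto)
        then show ?thesis by (simp add: F_def)
      qed auto
      moreover have "strict_mono (\<lambda>n. s (r n))" using s(1) r by (simp add: strict_mono_def)
      ultimately show ?thesis by (intro exI[of _ "\<lambda>n. s (r n)"]) blast
    qed
  qed
qed

text \<open>The omitted values may vary with the function. An affine change sends them to 0 and 1;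
  since the pairs stay in a compact set and their distance is at least \<open>R\<close>, a further
  subsequence makes the affine maps converge without degenerating.\<close>

lemma normal_family_if_omits_bounded_pair:
  assumes S: "open S" "connected S" and R: "R > 0"
    and hol: "\<And>h. h \<in> \<F> \<Longrightarrow> h holomorphic_on S"
    and omit: "\<And>h. h \<in> \<F> \<Longrightarrow> \<exists>p q. norm p \<le> R \<and> norm q = 2 * R \<and> p \<notin> h ` S \<and> q \<notin> h ` S"
  shows "normal_family_on \<F> S"
  unfolding normal_family_on_def
proof (intro allI impI)
  fix g :: "nat \<Rightarrow> complex \<Rightarrow> complex"
  assume g: "\<forall>n. g n \<in> \<F>"
  have "\<forall>n. \<exists>p q. norm p \<le> R \<and> norm q = 2 * R \<and> p \<notin> g n ` S \<and> q \<notin> g n ` S"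
    using omit g by blast
  then obtain p q where pq: "\<And>n. norm (p n) \<le> R" "\<And>n. norm (q n) = 2 * R"
     "\<And>n. p n \<notin> g n ` S" "\<And>n. q n \<notin> g n ` S"
    by metis
  have d: "norm (q n - p n) \<ge> R" for n
    using norm_triangle_ineq2[of "q n" "p n"] pq(1,2)[of n] by linarith
  have dnz: "q n \<noteq> p n" for n using d[of n] R by auto
  define h where "h = (\<lambda>n z. (g n z - p n) / (q n - p n))"
  have gh: "g n z = p n + (q n - p n) * h n z" for n z
    using dnz[of n] by (simp add: h_def field_simps)
  have hh: "h n holomorphic_on S" for n
    unfolding h_def using hol g dnz by (intro holomorphic_intros) auto
  have ho: "z \<in> S \<Longrightarrow> h n z \<noteq> 0 \<and> h n z \<noteq> 1" for n z
    unfolding h_def using pq(3,4)[of n] dnz[of n] by (auto simp: field_simps) (metis imageI)+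
  obtain s where s: "strict_mono s" and
     dich: "(\<exists>g. \<forall>K. K \<subseteq> S \<and> compact K \<longrightarrow> uniform_limit K (\<lambda>n. h (s n)) g sequentially)
           \<or> (\<forall>K. K \<subseteq> S \<and> compact K \<longrightarrow> (\<forall>B. \<forall>\<^sub>F n in sequentially. \<forall>z\<in>K. B \<le> norm (h (s n) z)))"
    using omitting_01_subsequence[of S h, OF S hh ho] by blast
  show "\<exists>r. strict_mono r \<and>
          ((\<exists>h. \<forall>K. K \<subseteq> S \<and> compact K \<longrightarrow> uniform_limit K (\<lambda>n. g (r n)) h sequentially)
           \<or> (\<forall>K. K \<subseteq> S \<and> compact K \<longrightarrow>
                (\<forall>B. \<forall>\<^sub>F n in sequentially. \<forall>z\<in>K. B \<le> norm (g (r n) z))))"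
    using dich
  proof
    assume "\<exists>g. \<forall>K. K \<subseteq> S \<and> compact K \<longrightarrow> uniform_limit K (\<lambda>n. h (s n)) g sequentially"
    then obtain u where u: "\<And>K. K \<subseteq> S \<Longrightarrow> compact K \<Longrightarrow> uniform_limit K (\<lambda>n. h (s n)) u sequentially"
      by auto
    have c: "seq_compact (cball (0::complex) R \<times> cball (0::complex) (2*R))"
      unfolding compact_eq_seq_compact_metric[symmetric] by (intro compact_Times compact_cball)
    have "\<forall>n. (p (s n), q (s n)) \<in> cball 0 R \<times> cball 0 (2*R)" using pq by simp
    then obtain l t where t: "strict_mono (t::nat\<Rightarrow>nat)" and lim: "((\<lambda>n. (p (s n), q (s n))) \<circ> t) \<longlonglongrightarrow> l"
      by (rule seq_compactE[OF c]) blast+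
    have lp: "(\<lambda>n. p (s (t n))) \<longlonglongrightarrow> fst l" and lq: "(\<lambda>n. q (s (t n))) \<longlonglongrightarrow> snd l"
      using tendsto_fst[OF lim] tendsto_snd[OF lim] by (auto simp: o_def)
    have "uniform_limit K (\<lambda>n. g (s (t n))) (\<lambda>z. fst l + (snd l - fst l) * u z) sequentially"
      if K: "K \<subseteq> S" "compact K" for K
    proof -
      have ul: "uniform_limit K (\<lambda>n. h (s (t n))) u sequentially"
        using u[OF K] eventually_subseq[OF t] unfolding uniform_limit_iff by blast
      have cu: "continuous_on K u"
        by (rule uniform_limit_theorem[OF _ ul]) (use hh K in \<open>auto intro!: always_eventually intro: holomorphic_on_imp_continuous_on holomorphic_on_subset\<close>)
      have bu: "bounded (u ` K)"
        using compact_continuous_image[OF cu K(2)] compact_imp_bounded by blast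
      have "uniform_limit K (\<lambda>n z. p (s (t n)) + (q (s (t n)) - p (s (t n))) * h (s (t n)) z) 
          (\<lambda>z. fst l + (snd l - fst l) * u z) sequentially"
      proof (intro uniform_limit_add uniform_lim_mult)
        show "uniform_limit K (\<lambda>n z. p (s (t n))) (\<lambda>z. fst l) sequentially"
          using lp by (auto simp: uniform_limit_iff tendsto_iff elim!: eventually_mono)
        have "(\<lambda>n. q (s (t n)) - p (s (t n))) \<longlonglongrightarrow> snd l - fst l"
          using lp lq by (intro tendsto_intros)
        then show "uniform_limit K (\<lambda>n z. q (s (t n)) - p (s (t n))) (\<lambda>z. snd l - fst l) sequentially"
          by (auto simp: uniform_limit_iff tendsto_iff elim!: eventually_mono)
        show "bounded ((\<lambda>z. snd l - fst l) ` K)"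
          by (rule bounded_subset[of "{snd l - fst l}"]) auto
      qed (use ul bu in \<open>auto\<close>)
      moreover have "(\<lambda>n. g (s (t n))) = (\<lambda>n z. p (s (t n)) + (q (s (t n)) - p (s (t n))) * h (s (t n)) z)"
        by (auto simp: gh fun_eq_iff)
      ultimately show ?thesis by simp
    qed
    moreover have "strict_mono (\<lambda>n. s (t n))" using s t by (simp add: strict_mono_def)
    ultimately show ?thesis by (intro exI[of _ "\<lambda>n. s (t n)"]) blast
  next
    assume a: "\<forall>K. K \<subseteq> S \<and> compact K \<longrightarrow> (\<forall>B. \<forall>\<^sub>F n in sequentially. \<forall>z\<in>K. B \<le> norm (h (s n) z))"
    have "\<forall>\<^sub>F n in sequentially. \<forall>z\<in>K. B \<le> norm (g (s n) z)" if K: "K \<subseteq> S" "compact K" for K B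
    proof -
      \<comment> \<open>The threshold comes from \<open>norm (g (s n) z)\<close> being at least
        \<open>R * norm (h (s n) z) - R\<close>.\<close>
      have "\<forall>\<^sub>F n in sequentially. \<forall>z\<in>K. (\<bar>B\<bar> + R) / R \<le> norm (h (s n) z)" using a K by blast
      then show ?thesis
      proof eventually_elim
        case (elim n)
        show ?case
        proof
          fix z assume "z \<in> K"
          with elim have "(\<bar>B\<bar> + R) / R \<le> norm (h (s n) z)" by blast
          then have "\<bar>B\<bar> + R \<le> R * norm (h (s n) z)" using R by (simp add: field_simps)
          also have "\<dots> \<le> norm ((q (s n) - p (s n)) * h (s n) z)"
            unfolding norm_mult using d by (intro mult_right_mono) auto
          finally show "B \<le> norm (g (s n) z)"
            using norm_triangle_ineq4[of "g (s n) z" "p (s n)"] pq(1)[of "s n"] gh[of "s n" z]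
            by simp
        qed
      qed
    qed
    then show ?thesis using s by blast
  qed
qed

section \<open>Iterates and blow-up at Julia points\<close>

lemma funpow_holomorphic:
  fixes f :: "complex \<Rightarrow> complex"
  assumes "f holomorphic_on UNIV"
  shows "(f ^^ n) holomorphic_on S"
proof -
  have "(f ^^ n) holomorphic_on UNIV"
  proof (induction n)
    case (Suc n)
    show ?case
      using holomorphic_on_compose[OF Suc holomorphic_on_subset[OF assms]] by (simp add: o_def)
  qed (simp add: id_def)
  then show ?thesis using holomorphic_on_subset by blast
qed

lemma funpow_continuous:
  fixes f :: "complex \<Rightarrow> complex"
  assumes "f holomorphic_on UNIV"
  shows "continuous_on S (f ^^ n)"
  using funpow_holomorphic[OF assms] holomorphic_on_imp_continuous_on by blast

lemma funpow_open_image: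
  fixes f :: "complex \<Rightarrow> complex"
  assumes "\<And>S. open S \<Longrightarrow> open (f ` S)" "open S"
  shows "open ((f ^^ n) ` S)"
proof (induction n)
  case (Suc n)
  have "(f ^^ Suc n) ` S = f ` (f ^^ n) ` S" by auto
  then show ?case using assms(1)[OF Suc] by simp
qed (simp add: assms(2))

lemma nonconstant_entire_open_image:
  assumes "f holomorphic_on UNIV" "\<not> f constant_on UNIV" "open S"
  shows "open (f ` S)"
  using open_mapping_thm[of f UNIV S] assms by (simp add: connected_UNIV)

text \<open>The image of the compact set \<open>closure G\<close> is closed, so a frontier point of
  the open image has a preimage in \<open>closure G\<close> but none in \<open>G\<close>.\<close>

lemma frontier_image_subset:
  fixes h :: "complex \<Rightarrow> complex"
  assumes h: "continuous_on UNIV h" and G: "bounded G" and op: "open (h ` G)"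
  shows "frontier (h ` G) \<subseteq> h ` frontier G"
proof -
  have "compact (h ` closure G)"
    using G h by (meson compact_closure compact_continuous_image continuous_on_subset subset_UNIV)
  then have "closure (h ` G) \<subseteq> h ` closure G"
    by (meson closure_minimal closure_subset compact_imp_closed image_mono)
  moreover have "interior (h ` G) = h ` G" using op by (simp add: interior_open)
  ultimately have "frontier (h ` G) \<subseteq> h ` closure G - h ` G" unfolding frontier_def by blast
  also have "\<dots> \<subseteq> h ` (closure G - interior G)" using interior_subset by blast
  finally show ?thesis unfolding frontier_def .
qed

lemma connected_unbounded_meets_sphere:
  fixes S :: "complex set"
  assumes "connected S" "p \<in> S" "norm p \<le> r" "\<not> bounded S"
  obtains q where "q \<in> S" "norm q = r"
proof -
  obtain x where x: "x \<in> S" "norm x > r" using assms(4) unfolding bounded_iff by (meson not_le)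
  have "connected (norm ` S)" by (intro connected_continuous_image continuous_intros assms)
  then have "r \<in> norm ` S"
    using connectedD_interval[of "norm ` S" "norm p" "norm x" r] assms x by auto
  then show ?thesis using that by auto
qed

text \<open>An iterate of \<open>G\<close> whose filled image misses a point of
  \<open>ball 0 R\<close> omits its whole outside, which is connected and unbounded, hence a value
  of modulus below \<open>R\<close> and one of modulus \<open>2 * R\<close>. If every iterate did
  so, a Julia point of \<open>G\<close> would be a point of normality. Filling the holes is what
  supplies the second omitted value at a controlled place.\<close>

lemma blow_up:
  fixes f :: "complex \<Rightarrow> complex"
  assumes f: "f holomorphic_on UNIV" and nc: "\<not> f constant_on UNIV"
    and G: "open G" "bounded G" "G \<inter> julia_set f \<noteq> {}" and R: "R > 0"
  obtains m D where "open D" "bounded D" "ball 0 R \<subseteq> D" "frontier D \<subseteq> (f ^^ m) ` frontier G"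
proof (cases "\<exists>m. ball 0 R \<inter> outside ((f ^^ m) ` G) = {}")
  case True
  then obtain m where m: "ball 0 R \<inter> outside ((f ^^ m) ` G) = {}" by auto
  define A where "A = (f ^^ m) ` G"
  have A: "open A" unfolding A_def using funpow_open_image[OF nonconstant_entire_open_image[OF f nc] G(1)] by blast
  have bA: "bounded A"
    unfolding A_def using G(2) funpow_continuous[OF f]
    by (metis bounded_subset closure_subset compact_closure compact_continuous_image compact_imp_bounded image_mono)
  \<comment> \<open>The witness \<open>D\<close> is the complement of this component, that is,
    \<open>A\<close> with its holes filled; the frontier of a complementary component stays in
    \<open>frontier A\<close>.\<close>
  have comp: "outside A \<in> components (- A)"
  proof -
    have "outside A \<noteq> {}" using bA by (simp add: outside_bounded_nonempty)
    then show ?thesis using connected_outside[OF bA] outside_in_components by auto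
  qed
  show ?thesis
  proof
    have "closed (outside A)" using comp A closed_components by blast
    then show "open (- outside A)" by blast
    show "bounded (- outside A)"
      using bA bounded_inside[OF bA] by (simp add: union_with_inside[symmetric])
    show "ball 0 R \<subseteq> - outside A" using m by (auto simp: A_def)
    have "frontier (- outside A) \<subseteq> frontier A"
      using frontier_of_components_subset[OF comp] by (simp add: frontier_complement)
    also have "\<dots> \<subseteq> (f ^^ m) ` frontier G"
      using frontier_image_subset[OF funpow_continuous[OF f] G(2)] A A_def by blast
    finally show "frontier (- outside A) \<subseteq> (f ^^ m) ` frontier G" .
  qed
next
  case False
  obtain z where z: "z \<in> G" "z \<in> julia_set f" using G by auto
  then obtain e where e: "e > 0" "ball z e \<subseteq> G" using G(1) open_contains_ball by blast
  have "normal_family_on (range (\<lambda>n. f ^^ n)) (ball z e)"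
  proof (rule normal_family_if_omits_bounded_pair[OF _ _ R])
    fix h assume "h \<in> range (\<lambda>n. f ^^ n)"
    then obtain n where h: "h = f ^^ n" by auto
    show "h holomorphic_on ball z e" using funpow_holomorphic[OF f] h by blast
    obtain p where "p \<in> ball 0 R \<inter> outside (h ` G)" using False h by blast
    then have p: "norm p < R" "p \<in> outside (h ` G)" by auto
    have b: "bounded (h ` G)"
      using G(2) funpow_continuous[OF f] h
      by (metis bounded_subset closure_subset compact_closure compact_continuous_image compact_imp_bounded image_mono)
    have c: "connected (outside (h ` G))" using connected_outside[OF b] by simp
    have u: "\<not> bounded (outside (h ` G))" using unbounded_outside[OF b] by blast
    obtain q where q: "q \<in> outside (h ` G)" "norm q = 2 * R"
      by (rule connected_unbounded_meets_sphere[OF c p(2) _ u, of "2*R"]) (use p R in auto)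
    show "\<exists>p q. norm p \<le> R \<and> norm q = 2 * R \<and> p \<notin> h ` ball z e \<and> q \<notin> h ` ball z e"
    proof (intro exI conjI)
      have "h ` ball z e \<subseteq> h ` G" using e by blast
      then show "p \<notin> h ` ball z e" "q \<notin> h ` ball z e"
        using p(2) q(1) outside_no_overlap[of "h ` G"] by blast+
    qed (use p q in auto)
  qed auto
  then have "z \<in> fatou_set f" unfolding fatou_set_def using e by (auto intro!: exI[of _ "ball z e"])
  then show ?thesis using z by (simp add: julia_set_def)
qed

section \<open>Pulling back through the logarithmic tract\<close>

locale log_tract =
  fixes f :: "complex \<Rightarrow> complex" and \<alpha> :: complex and r :: real and U :: "complex set"
  assumes entire: "f holomorphic_on UNIV"
    and nonconst: "\<not> f constant_on UNIV"
    and r_pos: "0 < r"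
    and tract: "U \<in> components (f -` ball \<alpha> r)"
    and image_tract: "f ` U = ball \<alpha> r - {\<alpha>}"
    and julia: "\<alpha> \<in> julia_set f"
begin

lemma open_image: "open S \<Longrightarrow> open (f ` S)"
  using nonconstant_entire_open_image entire nonconst by blast

lemma continuous: "continuous_on S f"
  using entire holomorphic_on_imp_continuous_on continuous_on_subset by blast

lemma open_tract: "open U"
proof -
  have "open (f -` ball \<alpha> r)" using open_vimage[OF open_ball continuous] .
  then show ?thesis using tract open_components by blast
qed

text \<open>A component of the preimage of the disc is relatively closed in that preimage.\<close>

lemma closure_tract:
  assumes "x \<in> closure U" "f x \<in> ball \<alpha> r"
  shows "x \<in> U"
proof -
  obtain T where T: "closed T" "U = f -` ball \<alpha> r \<inter> T"
    using closedin_component[OF tract] unfolding closedin_closed by blast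
  then have "closure U \<subseteq> T" by (metis closure_minimal inf_le2)
  then show ?thesis using T assms by auto
qed

lemma alpha_not_image_closure_tract: "x \<in> closure U \<Longrightarrow> f x \<noteq> \<alpha>"
  using closure_tract image_tract r_pos by fastforce

text \<open>Suppose that the component \<open>N0\<close> around \<alpha> reached the circle of
  radius \<open>r/2\<close>. Over the connected set \<open>N0 - {\<alpha>}\<close> the image of
  \<open>U \<inter> D\<close> is open, relatively closed by compactness, and nonempty because points
  of the circle have preimages in \<open>L\<close>. So it is everything, and values tending to
  \<alpha> contradict \<open>alpha_not_image_closure_tract\<close>.\<close>

lemma tract_pullback_domain:
  obtains L where "compact L"
    "\<And>D. open D \<Longrightarrow> bounded D \<Longrightarrow> L \<subseteq> D \<Longrightarrow>
       \<exists>G. open G \<and> \<alpha> \<in> G \<and> G \<subseteq> ball \<alpha> r \<and> frontier G \<subseteq> f ` frontier D"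
proof -
  have "\<forall>x\<in>U. \<exists>e>0. cball x e \<subseteq> U" using open_tract open_contains_cball by blast
  then obtain e where e: "\<And>x. x \<in> U \<Longrightarrow> e x > 0 \<and> cball x (e x) \<subseteq> U" by metis
  have cov: "sphere \<alpha> (r/2) \<subseteq> (\<Union>x\<in>U. f ` ball x (e x))"
  proof
    fix y assume "y \<in> sphere \<alpha> (r/2)"
    then have "y \<in> f ` U" unfolding image_tract using r_pos by (auto simp: dist_norm)
    then obtain x where "x \<in> U" "y = f x" by auto
    then show "y \<in> (\<Union>x\<in>U. f ` ball x (e x))" using e[of x] by (auto intro!: bexI[of _ x])
  qed
  have opn: "open (f ` ball x (e x))" for x by (rule open_image) auto
  obtain C where C: "C \<subseteq> U" "finite C" "sphere \<alpha> (r/2) \<subseteq> (\<Union>x\<in>C. f ` ball x (e x))"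
    by (rule compactE_image[OF compact_sphere opn cov]) blast
  \<comment> \<open>A finite union of closed discs inside \<open>U\<close> whose images cover the
    circle of radius \<open>r/2\<close>.\<close>
  define L where "L = (\<Union>x\<in>C. cball x (e x))"
  have L: "compact L" "L \<subseteq> U" "sphere \<alpha> (r/2) \<subseteq> f ` L"
  proof -
    show "compact L" unfolding L_def using C by (intro compact_UN) auto
    show "L \<subseteq> U" unfolding L_def using C e by blast
    have "(\<Union>x\<in>C. f ` ball x (e x)) \<subseteq> f ` L" unfolding L_def by fastforce
    then show "sphere \<alpha> (r/2) \<subseteq> f ` L" using C(3) by blast
  qed
  show ?thesis
  proof (rule that[OF L(1)])
    fix D :: "complex set" assume D: "open D" "bounded D" "L \<subseteq> D"
    define K where "K = f ` (frontier D \<inter> closure U)"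
    have compK: "compact K"
      unfolding K_def using D(2) 
      by (intro compact_continuous_image continuous compact_Int_closed compact_frontier_bounded) auto
    have \<alpha>K: "\<alpha> \<notin> K" unfolding K_def using alpha_not_image_closure_tract by auto
    have opB: "open (ball \<alpha> r - K)" using compK by (simp add: compact_imp_closed open_Diff)
    define N0 where "N0 = connected_component_set (ball \<alpha> r - K) \<alpha>"
    have N0: "open N0" "connected N0" "N0 \<subseteq> ball \<alpha> r - K" "\<alpha> \<in> N0"
      unfolding N0_def using opB \<alpha>K r_pos
      by (auto simp: open_connected_component connected_component_subset connected_component_refl_eq)
    have disj: "N0 \<inter> sphere \<alpha> (r/2) = {}"
    proof (rule ccontr)
      assume "N0 \<inter> sphere \<alpha> (r/2) \<noteq> {}"
      then obtain y where y: "y \<in> N0" "y \<in> sphere \<alpha> (r/2)" by blast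
      define N where "N = N0 - {\<alpha>}"
      have connN: "connected N" unfolding N_def using connected_open_delete[OF N0(1,2)] by simp
      define M where "M = U \<inter> D \<inter> f -` N"
      define Q where "Q = f ` (closure U \<inter> closure D)"
      have "compact Q"
        unfolding Q_def using D(2) compact_closure
        by (intro compact_continuous_image continuous closed_Int_compact) auto
      then have closedQ: "closed Q" using compact_imp_closed by blast
      have openN: "open N" unfolding N_def using N0(1) by (simp add: open_delete)
      have "open M" unfolding M_def using open_tract D(1) openN continuous
        by (intro open_Int open_vimage) auto
      then have "open (f ` M)" using open_image by blast
      then have oi: "openin (top_of_set N) (f ` M)"
        unfolding openin_open_eq[OF openN] by (auto simp: M_def)
      \<comment> \<open>Values in \<open>N\<close> avoid \<open>K\<close> and lie in the disc, so a
        preimage in \<open>closure U \<inter> closure D\<close> lies neither on the frontier of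
        \<open>D\<close> nor outside \<open>U\<close>.\<close>
      have MQ: "f ` M = N \<inter> Q"
      proof
        show "f ` M \<subseteq> N \<inter> Q"
          unfolding M_def Q_def using closure_subset[of U] closure_subset[of D] by blast
        show "N \<inter> Q \<subseteq> f ` M"
        proof
          fix z assume z: "z \<in> N \<inter> Q"
          then obtain x where x: "x \<in> closure U" "x \<in> closure D" "z = f x" unfolding Q_def by auto
          have "z \<in> ball \<alpha> r" "z \<notin> K" using z N0(3) unfolding N_def by auto
          then have "x \<in> U" "x \<in> D"
            using x closure_tract D(1) unfolding K_def frontier_def by (auto simp: interior_open)
          then show "z \<in> f ` M" using x z unfolding M_def by auto
        qed
      qed
      then have ci: "closedin (top_of_set N) (f ` M)" using closedQ by (simp add: closedin_closed_Int)
      have "y \<in> N" unfolding N_def using y r_pos by auto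
      moreover obtain l where "l \<in> L" "y = f l" using L(3) y(2) by blast
      ultimately have "y \<in> f ` M" unfolding M_def using L(2) D(3) by auto
      then have "f ` M = N" using connN oi ci unfolding connected_clopen by blast
      then have "N \<subseteq> Q" using MQ by blast
      then have "closure N \<subseteq> Q" using closedQ by (simp add: closure_minimal)
      moreover have "\<alpha> \<in> closure N"
      proof -
        have "\<alpha> islimpt N0" using N0 by (simp add: interior_limit_point interior_open)
        then have "\<alpha> islimpt N" unfolding N_def by (simp add: islimpt_def) blast
        then show ?thesis by (simp add: closure_def)
      qed
      ultimately show False unfolding Q_def using alpha_not_image_closure_tract by force
    qed
    \<comment> \<open>The smaller radius keeps \<open>frontier N0\<close> off the circle of radius
      \<open>r\<close>, so all of it must come from \<open>K\<close>.\<close>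
    have sub: "N0 \<subseteq> ball \<alpha> (r/2)"
    proof
      fix x assume x: "x \<in> N0"
      show "x \<in> ball \<alpha> (r/2)"
      proof (rule ccontr)
        assume "x \<notin> ball \<alpha> (r/2)"
        moreover have "connected (dist \<alpha> ` N0)"
          by (intro connected_continuous_image continuous_intros N0)
        ultimately have "r/2 \<in> dist \<alpha> ` N0"
          using connectedD_interval[of "dist \<alpha> ` N0" "dist \<alpha> \<alpha>" "dist \<alpha> x" "r/2"] x N0(4) r_pos by fastforce
        then show False using disj by auto
      qed
    qed
    have "frontier N0 \<subseteq> f ` frontier D"
    proof
      fix x assume x: "x \<in> frontier N0"
      then have "x \<in> closure N0" by (simp add: frontier_def)
      then have "x \<in> cball \<alpha> (r/2)" using sub by (meson closure_minimal closed_cball ball_subset_cball subset_iff subset_trans)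
      then have xb: "x \<in> ball \<alpha> r" using r_pos by auto
      have "frontier N0 \<subseteq> frontier (ball \<alpha> r - K)"
        unfolding N0_def by (rule frontier_of_connected_component_subset)
      then have "x \<notin> ball \<alpha> r - K" using x opB by (auto simp: frontier_def interior_open)
      then show "x \<in> f ` frontier D" using xb unfolding K_def by blast
    qed
    then show "\<exists>G. open G \<and> \<alpha> \<in> G \<and> G \<subseteq> ball \<alpha> r \<and> frontier G \<subseteq> f ` frontier D"
      using N0 by blast
  qed
qed

section \<open>Bungee points on frontiers of domains that meet the Julia set\<close>

lemma blow_up_through_tract:
  assumes G: "open G" "bounded G" "G \<inter> julia_set f \<noteq> {}"
  obtains m D G' where "open D" "bounded D" "ball 0 R \<subseteq> D" "frontier D \<subseteq> (f ^^ m) ` frontier G"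
    "open G'" "\<alpha> \<in> G'" "G' \<subseteq> ball \<alpha> r" "frontier G' \<subseteq> f ` frontier D"
proof -
  obtain L where L: "compact L" "\<And>D. open D \<Longrightarrow> bounded D \<Longrightarrow> L \<subseteq> D \<Longrightarrow>
       \<exists>G. open G \<and> \<alpha> \<in> G \<and> G \<subseteq> ball \<alpha> r \<and> frontier G \<subseteq> f ` frontier D"
    using tract_pullback_domain by blast
  obtain e where e: "e > 0" "L \<subseteq> ball 0 e"
    using compact_imp_bounded[OF L(1)] bounded_subset_ballD by blast
  have "max e R > 0" using e(1) by simp
  then obtain m D where D: "open D" "bounded D" "ball 0 (max e R) \<subseteq> D" "frontier D \<subseteq> (f ^^ m) ` frontier G"
    by (rule blow_up[OF entire nonconst G])
  have "L \<subseteq> D" "ball 0 R \<subseteq> D" using e D(3) by (auto simp: subset_iff)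
  then show ?thesis using that D L(2)[OF D(1,2)] by blast
qed

lemma julia_frontier_meets_bungee:
  assumes G: "open G" "bounded G" "G \<inter> julia_set f \<noteq> {}"
  shows "frontier G \<inter> bungee_set f \<noteq> {}"
proof -
  \<comment> \<open>A state is a domain together with the number of iterations elapsed, so that all
    stages refer to a single orbit starting on \<open>frontier G\<close>.\<close>
  define P where "P = (\<lambda>(n::nat) (x :: complex set \<times> nat). open (fst x) \<and> bounded (fst x) \<and>
     fst x \<inter> julia_set f \<noteq> {} \<and> (n > 0 \<longrightarrow> fst x \<subseteq> ball \<alpha> r) \<and> (n = 0 \<longrightarrow> x = (G, 0)))"
  \<comment> \<open>One step before landing on the new frontier the point is on
    \<open>frontier D\<close>, outside the disc of radius \<open>n\<close>; hence the exponent with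
    \<open>- 1\<close>.\<close>
  define Q where "Q = (\<lambda>(n::nat) (x :: complex set \<times> nat) (y :: complex set \<times> nat). snd x < snd y \<and>
     (\<forall>v\<in>frontier (fst y). \<exists>u\<in>frontier (fst x). real n \<le> norm ((f ^^ (snd y - snd x - 1)) u) \<and>
         (f ^^ (snd y - snd x)) u = v))"
  have "\<exists>F. \<forall>n. P n (F n) \<and> Q n (F n) (F (Suc n))"
  proof (rule dependent_nat_choice)
    show "\<exists>x. P 0 x" using G by (auto simp: P_def)
  next
    fix x n assume "P n x"
    then have x: "open (fst x)" "bounded (fst x)" "fst x \<inter> julia_set f \<noteq> {}" by (auto simp: P_def)
    obtain m D G' where D: "open D" "bounded D" "ball 0 (real n) \<subseteq> D" "frontier D \<subseteq> (f ^^ m) ` frontier (fst x)"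
      and G': "open G'" "\<alpha> \<in> G'" "G' \<subseteq> ball \<alpha> r" "frontier G' \<subseteq> f ` frontier D"
      by (rule blow_up_through_tract[OF x, of "real n"])
    have "P (Suc n) (G', snd x + m + 1)"
      using G' julia by (auto simp: P_def intro: bounded_subset[OF bounded_ball])
    moreover have "Q n x (G', snd x + m + 1)"
      unfolding Q_def
    proof (intro conjI ballI)
      fix v assume "v \<in> frontier (fst (G', snd x + m + 1))"
      then obtain w where w: "w \<in> frontier D" "v = f w" using G'(4) by auto
      then obtain u where u: "u \<in> frontier (fst x)" "w = (f ^^ m) u" using D(4) by blast
      have "w \<notin> ball 0 (real n)" using w(1) D(1,3) by (auto simp: frontier_def interior_open)
      then show "\<exists>u\<in>frontier (fst x). real n \<le> norm ((f ^^ (snd (G', snd x + m + 1) - snd x - 1)) u) \<and>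
         (f ^^ (snd (G', snd x + m + 1) - snd x)) u = v"
        using u w by (intro bexI[of _ u]) auto
    qed auto
    ultimately show "\<exists>y. P (Suc n) y \<and> Q n x y" by blast
  qed
  then obtain F where FP: "\<And>n. P n (F n)" and FQ: "\<And>n. Q n (F n) (F (Suc n))" by blast
  define M where "M = (\<lambda>n. snd (F n))"
  define H where "H = (\<lambda>n. fst (F n))"
  have F0: "H 0 = G" "M 0 = 0" using FP[of 0] by (auto simp: P_def H_def M_def)
  have Mlt: "M n < M (Suc n)" for n using FQ[of n] by (simp add: Q_def M_def)
  then have Mmono: "strict_mono M" by (simp add: strict_mono_Suc_iff)
  \<comment> \<open>Points of \<open>frontier G\<close> following the itinerary up to stage
    \<open>N\<close>. These sets are compact and decreasing, so a common point follows it for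
    ever.\<close>
  define X where "X = (\<lambda>N. {x \<in> frontier G. (\<forall>k\<le>N. (f ^^ M k) x \<in> frontier (H k)) \<and>
      (\<forall>k<N. real k \<le> norm ((f ^^ (M (Suc k) - 1)) x))})"
  \<comment> \<open>Stronger than the nonemptiness of \<open>X N\<close> that is needed: reaching
    every frontier point of stage \<open>N\<close> lets the induction choose the target first and
    lift it backwards.\<close>
  have surj: "\<forall>v\<in>frontier (H N). \<exists>x\<in>X N. (f ^^ M N) x = v" for N
  proof (induction N)
    case 0
    then show ?case by (auto simp: X_def F0)
  next
    case (Suc N)
    show ?case
    proof
      fix v assume v: "v \<in> frontier (H (Suc N))"
      then obtain u where u: "u \<in> frontier (H N)" "real N \<le> norm ((f ^^ (M (Suc N) - M N - 1)) u)"
        "(f ^^ (M (Suc N) - M N)) u = v"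
        using FQ[of N] by (auto simp: Q_def H_def M_def)
      then obtain x where x: "x \<in> X N" "(f ^^ M N) x = u" using Suc by blast
      have e1: "(f ^^ (M (Suc N) - 1)) x = (f ^^ (M (Suc N) - M N - 1)) u"
        using Mlt[of N] unfolding x(2)[symmetric] funpow_add[symmetric, THEN fun_cong, unfolded o_apply]
        by (intro arg_cong[of _ _ "\<lambda>k. (f ^^ k) x"]) simp
      have e2: "(f ^^ M (Suc N)) x = v"
        using Mlt[of N] unfolding u(3)[symmetric] x(2)[symmetric] funpow_add[symmetric, THEN fun_cong, unfolded o_apply]
        by (intro arg_cong[of _ _ "\<lambda>k. (f ^^ k) x"]) simp
      have "x \<in> X (Suc N)"
        using x(1) u(2) v e1 e2 unfolding X_def by (auto simp: le_Suc_eq less_Suc_eq)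
      then show "\<exists>x\<in>X (Suc N). (f ^^ M (Suc N)) x = v" using e2 by blast
    qed
  qed
  have ne: "X N \<noteq> {}" for N
  proof -
    have "H N \<noteq> {}" "bounded (H N)" using FP[of N] by (auto simp: P_def H_def)
    then have "frontier (H N) \<noteq> {}" by (auto simp: frontier_eq_empty)
    then show ?thesis using surj[of N] by blast
  qed
  have cX: "compact (X N)" for N
  proof -
    have "closed {x. (f ^^ k) x \<in> frontier S}" for k S
      using closed_vimage[OF frontier_closed[of S] funpow_continuous[OF entire, of UNIV k]] by (simp add: vimage_def)
    moreover have "closed {x. real k \<le> norm ((f ^^ m) x)}" for k m
      by (intro closed_Collect_le continuous_intros funpow_continuous[OF entire])
    ultimately have "closed {x. (\<forall>k\<le>N. (f ^^ M k) x \<in> frontier (H k)) \<and> (\<forall>k<N. real k \<le> norm ((f ^^ (M (Suc k) - 1)) x))}"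
      by (intro closed_Collect_conj closed_Collect_all closed_Collect_imp open_Collect_const)
    moreover have "X N = frontier G \<inter> {x. (\<forall>k\<le>N. (f ^^ M k) x \<in> frontier (H k)) \<and> (\<forall>k<N. real k \<le> norm ((f ^^ (M (Suc k) - 1)) x))}"
      unfolding X_def by auto
    ultimately show ?thesis using compact_Int_closed[OF compact_frontier_bounded[OF G(2)]] by simp
  qed
  have "\<Inter> (range X) \<noteq> {}"
    by (rule compact_nest) (use cX ne in \<open>auto simp: X_def\<close>)
  then obtain z where z: "\<And>N. z \<in> X N" by auto
  have zG: "z \<in> frontier G" using z[of 0] by (simp add: X_def)
  have zH: "(f ^^ M k) z \<in> frontier (H k)" for k using z[of k] by (simp add: X_def)
  have zk: "real k \<le> norm ((f ^^ (M (Suc k) - 1)) z)" for k using z[of "Suc k"] by (simp add: X_def)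
  have "z \<notin> bounded_orbit_set f"
  proof
    assume "z \<in> bounded_orbit_set f"
    then obtain K where K: "\<And>n. norm ((f ^^ n) z) < K" by (auto simp: bounded_orbit_set_def)
    obtain k where "K \<le> real k" using real_arch_simple by blast
    then show False using K[of "M (Suc k) - 1"] zk[of k] by linarith
  qed
  moreover have "z \<notin> escaping_set f"
  proof
    assume "z \<in> escaping_set f"
    then have "filterlim (\<lambda>n. (f ^^ n) z) at_infinity sequentially" by (simp add: escaping_set_def)
    then have "filterlim (\<lambda>k. (f ^^ M k) z) at_infinity sequentially"
      using filterlim_compose filterlim_subseq[OF Mmono] by blast
    then have "\<forall>\<^sub>F k in sequentially. norm \<alpha> + r + 1 \<le> norm ((f ^^ M k) z)"
      unfolding filterlim_at_infinity[OF order_refl] using norm_ge_zero[of \<alpha>] r_pos by (auto simp del: norm_ge_zero)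
    then obtain N where N: "\<And>k. k \<ge> N \<Longrightarrow> norm \<alpha> + r + 1 \<le> norm ((f ^^ M k) z)"
      unfolding eventually_sequentially by blast
    define k where "k = Suc N"
    have k: "k > 0" "norm \<alpha> + r + 1 \<le> norm ((f ^^ M k) z)" using N[of k] by (auto simp: k_def)
    have "H k \<subseteq> ball \<alpha> r" using FP[of k] k(1) by (auto simp: P_def H_def)
    then have "closure (H k) \<subseteq> cball \<alpha> r" by (meson ball_subset_cball closed_cball closure_minimal order_trans)
    then have "(f ^^ M k) z \<in> cball \<alpha> r" using zH[of k] by (auto simp: frontier_def)
    then have "norm ((f ^^ M k) z - \<alpha>) \<le> r" by (simp add: dist_norm norm_minus_commute)
    then show False using k(2) norm_triangle_ineq2[of "(f ^^ M k) z" \<alpha>] by linarith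
  qed
  ultimately show ?thesis using zG by (auto simp: bungee_set_def)
qed

end

section \<open>Fatou continua do not enclose Julia points\<close>

lemma open_fatou_set: "open (fatou_set f)"
proof -
  have "fatou_set f = \<Union>{U. open U \<and> normal_family_on (range (\<lambda>n. f ^^ n)) U}"
    by (auto simp: fatou_set_def)
  then show ?thesis by auto
qed

lemma closed_julia_set: "closed (julia_set f)"
  unfolding julia_set_def using open_fatou_set closed_Compl by blast

lemma fatou_set_cball:
  assumes "x \<in> fatou_set f"
  obtains e U where "e > 0" "cball x e \<subseteq> U" "normal_family_on (range (\<lambda>n. f ^^ n)) U"
  using assms open_contains_cball unfolding fatou_set_def by blast

text \<open>Local normality alone only yields a dichotomy on each disc of a finite cover;
  connectedness of the compact set forces the same alternative on all of them.\<close>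

lemma bounded_iterates_on_connected_compact:
  fixes f :: "complex \<Rightarrow> complex" and n :: "nat \<Rightarrow> nat"
  assumes f: "f holomorphic_on UNIV" and C: "compact C" "connected C" "C \<subseteq> fatou_set f"
    and pt: "\<And>j. \<exists>x\<in>C. norm ((f ^^ n j) x) \<le> B"
  shows "\<exists>K. infinite {j. \<forall>x\<in>C. norm ((f ^^ n j) x) \<le> K}"
proof -
  have "\<forall>x\<in>C. \<exists>e>0. \<exists>U. cball x e \<subseteq> U \<and> normal_family_on (range (\<lambda>n. f ^^ n)) U"
    using fatou_set_cball C(3) by (metis subset_iff)
  then obtain e where e: "\<And>x. x \<in> C \<Longrightarrow> e x > 0"
    "\<And>x. x \<in> C \<Longrightarrow> \<exists>U. cball x (e x) \<subseteq> U \<and> normal_family_on (range (\<lambda>n. f ^^ n)) U"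
    by metis
  define bd where "bd = (\<lambda>(s::nat\<Rightarrow>nat) x. \<exists>K. \<forall>\<^sub>F j in sequentially. \<forall>z\<in>cball x (e x). norm ((f ^^ n (s j)) z) \<le> K)"
  define inft where "inft = (\<lambda>(s::nat\<Rightarrow>nat) x. \<forall>K. \<forall>\<^sub>F j in sequentially. \<forall>z\<in>cball x (e x). K \<le> norm ((f ^^ n (s j)) z))"
  have sub: "bd (\<lambda>j. s (t j)) x" if "bd s x" "strict_mono t" for s and t :: "nat\<Rightarrow>nat" and x
    using that eventually_subseq[OF that(2)] unfolding bd_def by blast
  have sub': "inft (\<lambda>j. s (t j)) x" if "inft s x" "strict_mono t" for s and t :: "nat\<Rightarrow>nat" and x
    using that eventually_subseq[OF that(2)] unfolding inft_def by blast
  have one: "\<exists>t::nat\<Rightarrow>nat. strict_mono t \<and> (bd (\<lambda>j. s (t j)) x \<or> inft (\<lambda>j. s (t j)) x)" if x: "x \<in> C" for s :: "nat\<Rightarrow>nat" and x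
  proof -
    obtain U where U: "cball x (e x) \<subseteq> U" "normal_family_on (range (\<lambda>n. f ^^ n)) U" using e(2)[OF x] by blast
    obtain t where t: "strict_mono t" and
      alt: "(\<exists>h. \<forall>K. K \<subseteq> U \<and> compact K \<longrightarrow> uniform_limit K (\<lambda>j. f ^^ n (s (t j))) h sequentially)
           \<or> (\<forall>K. K \<subseteq> U \<and> compact K \<longrightarrow> (\<forall>B. \<forall>\<^sub>F j in sequentially. \<forall>z\<in>K. B \<le> norm ((f ^^ n (s (t j))) z)))"
      using U(2)[unfolded normal_family_on_def, rule_format, of "\<lambda>j. f ^^ n (s j)"] by blast
    from alt show ?thesis
    proof
      assume "\<exists>h. \<forall>K. K \<subseteq> U \<and> compact K \<longrightarrow> uniform_limit K (\<lambda>j. f ^^ n (s (t j))) h sequentially"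
      then obtain h where h: "uniform_limit (cball x (e x)) (\<lambda>j. f ^^ n (s (t j))) h sequentially"
        using U(1) compact_cball by blast
      have "continuous_on (cball x (e x)) h"
        by (rule uniform_limit_theorem[OF _ h]) (auto intro!: always_eventually funpow_continuous[OF f])
      then have "bounded (h ` cball x (e x))"
        using compact_cball compact_continuous_image compact_imp_bounded by blast
      then obtain K where K: "\<And>z. z \<in> cball x (e x) \<Longrightarrow> norm (h z) \<le> K" unfolding bounded_iff by blast
      have "\<forall>\<^sub>F j in sequentially. \<forall>z\<in>cball x (e x). dist ((f ^^ n (s (t j))) z) (h z) < 1"
        by (rule uniform_limitD[OF h]) simp
      then have "\<forall>\<^sub>F j in sequentially. \<forall>z\<in>cball x (e x). norm ((f ^^ n (s (t j))) z) \<le> K + 1"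
      proof eventually_elim
        case (elim j)
        show ?case
        proof
          fix z assume z: "z \<in> cball x (e x)"
          then have "norm ((f ^^ n (s (t j))) z - h z) < 1" using elim by (simp add: dist_norm)
          then show "norm ((f ^^ n (s (t j))) z) \<le> K + 1"
            using K[OF z] norm_triangle_ineq2[of "(f ^^ n (s (t j))) z" "h z"] by linarith
        qed
      qed
      then show ?thesis using t unfolding bd_def by blast
    next
      assume "\<forall>K. K \<subseteq> U \<and> compact K \<longrightarrow> (\<forall>B. \<forall>\<^sub>F j in sequentially. \<forall>z\<in>K. B \<le> norm ((f ^^ n (s (t j))) z))"
      then have "inft (\<lambda>j. s (t j)) x" unfolding inft_def using U(1) compact_cball by blast
      then show ?thesis using t by blast
    qed
  qed
  have fin: "finite T \<Longrightarrow> T \<subseteq> C \<Longrightarrow> \<exists>t. strict_mono t \<and> (\<forall>x\<in>T. bd t x \<or> inft t x)" for T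
  proof (induction T rule: finite_induct)
    case empty
    then show ?case by (auto intro!: exI[of _ id] simp: strict_mono_id)
  next
    case (insert x T)
    then obtain t where t: "strict_mono t" "\<forall>x\<in>T. bd t x \<or> inft t x" by auto
    obtain u where u: "strict_mono u" "bd (\<lambda>j. t (u j)) x \<or> inft (\<lambda>j. t (u j)) x" using one[of x t] insert by auto
    have "strict_mono (\<lambda>j. t (u j))" using t u by (simp add: strict_mono_def)
    then show ?case using t(2) u sub sub' by (intro exI[of _ "\<lambda>j. t (u j)"]) blast
  qed
  have cv: "C \<subseteq> (\<Union>x\<in>C. ball x (e x))" using e(1) by fastforce
  obtain T where T: "T \<subseteq> C" "finite T" "C \<subseteq> (\<Union>x\<in>T. ball x (e x))"
    by (rule compactE_image[OF C(1) _ cv]) auto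
  obtain t where t: "strict_mono t" "\<And>x. x \<in> T \<Longrightarrow> bd t x \<or> inft t x" using fin[OF T(2,1)] by blast
  define T1 where "T1 = {x\<in>T. bd t x}"
  define T2 where "T2 = {x\<in>T. inft t x}"
  define V1 where "V1 = (\<Union>x\<in>T1. ball x (e x))"
  define V2 where "V2 = (\<Union>x\<in>T2. ball x (e x))"
  \<comment> \<open>A common point of two discs of different kinds would have iterates both bounded
    and tending to infinity along \<open>t\<close>.\<close>
  have disj: "V1 \<inter> V2 = {}"
  proof (rule ccontr)
    assume "\<not> ?thesis"
    then obtain x y z where xyz: "bd t x" "inft t y" "z \<in> ball x (e x)" "z \<in> ball y (e y)"
      unfolding V1_def V2_def T1_def T2_def by blast
    then have z: "z \<in> cball x (e x)" "z \<in> cball y (e y)" by auto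
    obtain K where "\<forall>\<^sub>F j in sequentially. \<forall>z\<in>cball x (e x). norm ((f ^^ n (t j)) z) \<le> K"
      using xyz(1) unfolding bd_def by blast
    moreover have "\<forall>\<^sub>F j in sequentially. \<forall>z\<in>cball y (e y). K + 1 \<le> norm ((f ^^ n (t j)) z)"
      using xyz(2) unfolding inft_def by blast
    ultimately have "\<forall>\<^sub>F j in sequentially. False"
    proof eventually_elim
      case (elim j)
      then have "norm ((f ^^ n (t j)) z) \<le> K" "K + 1 \<le> norm ((f ^^ n (t j)) z)" using z by blast+
      then show ?case by linarith
    qed
    then show False by simp
  qed
  have cov: "C \<subseteq> V1 \<union> V2"
    using T(3) t(2) unfolding V1_def V2_def T1_def T2_def by blast
  have "V1 \<inter> C = {} \<or> V2 \<inter> C = {}"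
  proof (rule connectedD[OF C(2)])
    show "V1 \<inter> V2 \<inter> C = {}" using disj by blast
    show "C \<subseteq> V1 \<union> V2" by (rule cov)
  qed (auto simp: V1_def V2_def)
  then show ?thesis
  proof
    \<comment> \<open>If all discs diverge, this contradicts the points of bounded value supplied by
      \<open>pt\<close>.\<close>
    assume "V1 \<inter> C = {}"
    then have C2: "C \<subseteq> V2" using cov by blast
    have "\<forall>\<^sub>F j in sequentially. \<forall>x\<in>T2. \<forall>z\<in>cball x (e x). B + 1 \<le> norm ((f ^^ n (t j)) z)"
      using T(2) by (intro eventually_ball_finite) (auto simp: T2_def inft_def)
    then obtain j where j: "\<forall>x\<in>T2. \<forall>z\<in>cball x (e x). B + 1 \<le> norm ((f ^^ n (t j)) z)"
      using eventually_happens'[OF sequentially_bot] by blast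
    obtain z where z: "z \<in> C" "norm ((f ^^ n (t j)) z) \<le> B" using pt by blast
    then obtain x where "x \<in> T2" "z \<in> cball x (e x)" using C2 ball_subset_cball unfolding V2_def by blast
    then have "B + 1 \<le> norm ((f ^^ n (t j)) z)" using j by blast
    then have False using z(2) by linarith
    then show ?thesis ..
  next
    assume "V2 \<inter> C = {}"
    then have C1: "C \<subseteq> V1" using cov by blast
    have "\<forall>x\<in>T1. \<exists>K. \<forall>\<^sub>F j in sequentially. \<forall>z\<in>cball x (e x). norm ((f ^^ n (t j)) z) \<le> K"
      by (simp add: T1_def bd_def)
    from bchoice[OF this]
    obtain K where K: "\<forall>x\<in>T1. \<forall>\<^sub>F j in sequentially. \<forall>z\<in>cball x (e x). norm ((f ^^ n (t j)) z) \<le> K x" ..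
    have fT: "finite T1" using T(2) by (simp add: T1_def)
    define K' where "K' = (\<Sum>x\<in>T1. \<bar>K x\<bar>)"
    have K': "K x \<le> K'" if "x \<in> T1" for x
      using member_le_sum[of x T1 "\<lambda>x. \<bar>K x\<bar>"] fT that unfolding K'_def by fastforce
    have "\<forall>\<^sub>F j in sequentially. \<forall>x\<in>T1. \<forall>z\<in>cball x (e x). norm ((f ^^ n (t j)) z) \<le> K x"
      using fT K by (rule eventually_ball_finite)
    then have "\<forall>\<^sub>F j in sequentially. \<forall>z\<in>C. norm ((f ^^ n (t j)) z) \<le> K'"
    proof eventually_elim
      case (elim j)
      show ?case
      proof
        fix z assume "z \<in> C"
        then obtain x where x: "x \<in> T1" "z \<in> cball x (e x)" using C1 ball_subset_cball unfolding V1_def by blast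
        then have "norm ((f ^^ n (t j)) z) \<le> K x" using elim by blast
        then show "norm ((f ^^ n (t j)) z) \<le> K'" using K'[OF x(1)] by linarith
      qed
    qed
    then obtain N where N: "\<And>j. j \<ge> N \<Longrightarrow> \<forall>z\<in>C. norm ((f ^^ n (t j)) z) \<le> K'"
      unfolding eventually_sequentially by blast
    have "t ` {N..} \<subseteq> {j. \<forall>x\<in>C. norm ((f ^^ n j) x) \<le> K'}" using N by auto
    moreover have "infinite (t ` {N..})"
      using finite_imageD[OF _ inj_on_subset[OF strict_mono_imp_inj_on[OF t(1)] subset_UNIV]] infinite_Ici by blast
    ultimately show ?thesis using infinite_super by blast
  qed
qed

context log_tract begin

text \<open>Blowing up \<open>D\<close> gives iterates that wrap \<open>C\<close> around ever larger
  discs, while one further application of \<open>f\<close> brings some point of \<open>C\<close>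
  near \<alpha>. As \<open>C\<close> is connected in the Fatou set, infinitely many of these longer
  iterates share a bound on all of \<open>C\<close>. So \<open>f\<close> is bounded by it on curves
  around arbitrarily large discs, and the maximum principle and Liouville make \<open>f\<close>
  constant.\<close>

lemma connected_fatou_frontier_impossible:
  assumes D: "open D" "bounded D" "D \<inter> julia_set f \<noteq> {}"
    and C: "frontier D \<subseteq> C" "compact C" "connected C" "C \<subseteq> fatou_set f"
  shows False
proof -
  have "\<exists>m. (\<exists>x\<in>C. norm ((f ^^ Suc m) x) \<le> norm \<alpha> + r) \<and>
      (\<forall>K. (\<forall>x\<in>C. norm ((f ^^ Suc m) x) \<le> K) \<longrightarrow> (\<forall>z. norm z < real j \<longrightarrow> norm (f z) \<le> K))" for j
  proof -
    obtain m E G' where E: "open E" "bounded E" "ball 0 (real j) \<subseteq> E" "frontier E \<subseteq> (f ^^ m) ` frontier D"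
      and G': "open G'" "\<alpha> \<in> G'" "G' \<subseteq> ball \<alpha> r" "frontier G' \<subseteq> f ` frontier E"
      by (rule blow_up_through_tract[OF D])
    have "bounded G'" using G'(3) bounded_subset bounded_ball by blast
    then have "G' \<noteq> UNIV" by auto
    then have "frontier G' \<noteq> {}" using G'(2) by (auto simp: frontier_eq_empty)
    then obtain y where y: "y \<in> frontier G'" by blast
    have "closure G' \<subseteq> cball \<alpha> r"
      using G'(3) by (meson ball_subset_cball closed_cball closure_minimal order_trans)
    then have "norm (y - \<alpha>) \<le> r" using y by (auto simp: frontier_def dist_norm norm_minus_commute)
    then have ny: "norm y \<le> norm \<alpha> + r" using norm_triangle_ineq2[of y \<alpha>] by linarith
    obtain w where w: "w \<in> frontier E" "y = f w" using G'(4) y by blast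
    then obtain x where x: "x \<in> frontier D" "w = (f ^^ m) x" using E(4) by blast
    have "norm (f z) \<le> K" if K: "\<forall>x\<in>C. norm ((f ^^ Suc m) x) \<le> K" and z: "norm z < real j" for K z
    proof (rule maximum_modulus_frontier[OF holomorphic_on_subset[OF entire] continuous E(2)])
      show "norm (f w) \<le> K" if w: "w \<in> frontier E" for w
      proof -
        obtain x where "x \<in> frontier D" "w = (f ^^ m) x" using w E(4) by blast
        then show ?thesis using C(1) K by auto
      qed
      show "z \<in> E" using E(3) z by auto
    qed auto
    moreover have "\<exists>x\<in>C. norm ((f ^^ Suc m) x) \<le> norm \<alpha> + r"
      using C(1) ny w x by (intro bexI[of _ x]) auto
    ultimately show ?thesis by blast
  qed
  then obtain m where m: "\<And>j. \<exists>x\<in>C. norm ((f ^^ Suc (m j)) x) \<le> norm \<alpha> + r"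
      "\<And>j K z. (\<forall>x\<in>C. norm ((f ^^ Suc (m j)) x) \<le> K) \<Longrightarrow> norm z < real j \<Longrightarrow> norm (f z) \<le> K"
    by metis
  obtain K where K: "infinite {j. \<forall>x\<in>C. norm ((f ^^ Suc (m j)) x) \<le> K}"
    using bounded_iterates_on_connected_compact[OF entire C(2-4), of "\<lambda>j. Suc (m j)", OF m(1)] by blast
  have "norm (f z) \<le> K" for z
  proof -
    obtain N where "norm z < real N" using reals_Archimedean2 by blast
    moreover obtain j where "N < j" "j \<in> {j. \<forall>x\<in>C. norm ((f ^^ Suc (m j)) x) \<le> K}"
      using K unfolding infinite_nat_iff_unbounded by blast
    ultimately show ?thesis using m(2)[of j K z] by auto
  qed
  then have "bounded (range f)" unfolding bounded_iff by blast
  then show False using Liouville_theorem[OF entire] nonconst by blast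
qed

end

section \<open>Continua in the Julia set and simple connectivity of Fatou domains\<close>

lemma frontier_closure_subset: "frontier (closure S) \<subseteq> frontier S"
  unfolding frontier_def using interior_mono[OF closure_subset[of S]] by auto

text \<open>By Sura-Bura, \<open>C\<close> has a compact relatively open neighbourhood
  \<open>K\<close> in \<open>Z\<close> inside \<open>W\<close>. Disjoint open sets then separate
  \<open>K\<close> from \<open>T\<close>, which joins the rest of \<open>Z\<close> to the complement
  of \<open>W\<close>, so one separation gives both \<open>V \<subseteq> W\<close> and a frontier
  off \<open>Z\<close>.\<close>

lemma component_enclosing_domain:
  fixes Z :: "complex set"
  assumes Z: "closed Z" and C: "C \<in> components Z" "compact C" and W: "open W" "C \<subseteq> W"
  obtains V where "open V" "bounded V" "connected V" "C \<subseteq> V" "V \<subseteq> W" "frontier V \<inter> Z = {}"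
proof -
  obtain K where K: "openin (top_of_set Z) K" "compact K" "C \<subseteq> K" "K \<subseteq> W"
    using Sura_Bura_clopen_subset[OF closed_imp_locally_compact[OF Z] C W] by blast
  define T where "T = (Z - K) \<union> - W"
  have "closed (Z - K)"
    using K(1) Z by (meson closedin_closed_trans closedin_diff closedin_subtopology_refl openin_imp_subset subset_refl topspace_euclidean_subtopology closedin_self closedin_closed_eq)
  then have T: "closed T" unfolding T_def using W(1) by blast
  have "K \<inter> T = {}" unfolding T_def using K(4) by blast
  then obtain A B where AB: "open A" "compact (closure A)" "open B" "K \<subseteq> A" "T \<subseteq> B" "A \<inter> B = {}"
    using separation_normal_compact[OF K(2) T] by metis
  have AT: "closure A \<inter> T = {}" using AB by (metis disjoint_iff open_Int_closure_eq_empty subsetD inf_commute)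
  obtain c where c: "c \<in> C" using C(1) in_components_nonempty by blast
  define V where "V = connected_component_set A c"
  have cA: "c \<in> A" using c K(3) AB(4) by blast
  show ?thesis
  proof
    show "open V" unfolding V_def using AB(1) open_connected_component by blast
    have VA: "V \<subseteq> A" unfolding V_def by (rule connected_component_subset)
    show "bounded V" using VA AB(2) bounded_subset closure_subset compact_imp_bounded by (metis subset_trans)
    show "connected V" unfolding V_def by simp
    show "C \<subseteq> V" unfolding V_def
      by (rule connected_component_maximal[OF c]) (use C(1) in_components_connected K(3) AB(4) in auto)
    show "V \<subseteq> W" using VA AT closure_subset[of A] unfolding T_def by blast
    have "frontier V \<subseteq> closure A - A"
      using frontier_of_connected_component_subset[of A c] AB(1) unfolding V_def by (simp add: frontier_def interior_open)
    then show "frontier V \<inter> Z = {}" using AT AB(4) unfolding T_def by blast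
  qed
qed

context log_tract begin

text \<open>If the component of the circle of radius \<open>S\<close> stopped before radius
  \<open>T\<close>, a thin domain around it would have frontier off \<open>Z\<close>. Its
  complementary component around 0 contains \<alpha>, since \<open>norm \<alpha> < T\<close>, and
  has connected frontier in the Fatou set, against
  \<open>connected_fatou_frontier_impossible\<close>.\<close>

lemma julia_continuum_to_sphere:
  assumes T: "norm \<alpha> < T" "T < S"
  obtains L c where "compact L" "connected L" "sphere 0 S \<subseteq> L" "c \<in> L" "norm c = T"
    "L \<subseteq> (julia_set f \<inter> cball 0 S - ball 0 T) \<union> sphere 0 S"
proof -
  \<comment> \<open>Adding the whole circle makes \<open>L\<close> surround the disc, which traps
    the component \<open>D\<close> constructed below inside \<open>ball 0 S\<close>.\<close>
  define Z where "Z = (julia_set f \<inter> cball 0 S - ball 0 T) \<union> sphere 0 S"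
  have Tpos: "T > 0" using T(1) norm_ge_zero[of \<alpha>] by linarith
  have compZ: "compact Z" unfolding Z_def
    by (intro compact_Un compact_sphere compact_diff closed_Int_compact closed_julia_set compact_cball open_ball)
  define s where "s = complex_of_real S"
  have s: "s \<in> sphere 0 S" using T Tpos by (simp add: s_def)
  define L where "L = connected_component_set Z s"
  have sZ: "s \<in> Z" using s by (simp add: Z_def)
  have comp: "L \<in> components Z" unfolding L_def using sZ by (rule componentsI)
  have compL: "compact L" using compact_components[OF compZ comp] .
  have connL: "connected L" unfolding L_def by simp
  have sphL: "sphere 0 S \<subseteq> L" unfolding L_def
    by (rule connected_component_maximal[OF s]) (auto simp: connected_sphere Z_def)
  have LZ: "L \<subseteq> Z" unfolding L_def by (rule connected_component_subset)
  have "\<exists>c\<in>L. norm c = T"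
  proof (rule ccontr)
    assume no: "\<not> ?thesis"
    have LW: "L \<subseteq> - cball 0 T"
    proof
      fix x assume x: "x \<in> L"
      then have "norm x \<ge> T" using LZ T(2) by (auto simp: Z_def)
      moreover have "norm x \<noteq> T" using no x by blast
      ultimately show "x \<in> - cball 0 T" by simp
    qed
    obtain V where V: "open V" "bounded V" "connected V" "L \<subseteq> V" "V \<subseteq> - cball 0 T" "frontier V \<inter> Z = {}"
      using component_enclosing_domain[OF compact_imp_closed[OF compZ] comp compL _ LW] by auto
    have bV: "ball 0 T \<inter> closure V = {}"
      using V(5) open_Int_closure_eq_empty[OF open_ball, of 0 T V] ball_subset_cball by blast
    \<comment> \<open>The frontier of \<open>V\<close> may be disconnected; that of one
      complementary component of the connected set \<open>closure V\<close> is not.\<close>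
    define D where "D = connected_component_set (- closure V) 0"
    have D0: "0 \<in> - closure V" using bV Tpos centre_in_ball[of 0 T] by blast
    have opD: "open D" unfolding D_def by (intro open_connected_component) auto
    have compD: "D \<in> components (- closure V)" unfolding D_def using D0 by (rule componentsI)
    have ballD: "ball 0 T \<subseteq> D" unfolding D_def
      by (rule connected_component_maximal) (use Tpos bV in auto)
    have Dsub: "D \<subseteq> - closure V" unfolding D_def by (rule connected_component_subset)
    have DS: "D \<subseteq> ball 0 S"
    proof
      fix x assume x: "x \<in> D"
      show "x \<in> ball 0 S"
      proof (rule ccontr)
        assume "x \<notin> ball 0 S"
        moreover have "connected (norm ` D)"
          by (intro connected_continuous_image continuous_intros) (simp add: D_def)
        moreover have "0 \<in> D" using ballD Tpos by auto
        ultimately have "S \<in> norm ` D"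
          using connectedD_interval[of "norm ` D" "norm (0::complex)" "norm x" S] x T Tpos by force
        then obtain y where "y \<in> D" "y \<in> sphere 0 S" by auto
        then show False using sphL V(4) Dsub closure_subset[of V] by blast
      qed
    qed
    have frD: "frontier D \<subseteq> frontier V"
    proof -
      have "frontier D \<subseteq> frontier (- closure V)" using frontier_of_components_subset[OF compD] .
      then show ?thesis using frontier_closure_subset[of V] by (simp add: frontier_complement)
    qed
    have "frontier D \<subseteq> fatou_set f"
    proof
      fix x assume x: "x \<in> frontier D"
      have "x \<notin> Z" using x frD V(6) by blast
      moreover have "x \<in> cball 0 S"
      proof -
        have "closure D \<subseteq> cball 0 S" using DS by (meson ball_subset_cball closed_cball closure_minimal order_trans)
        then show ?thesis using x by (auto simp: frontier_def)
      qed
      moreover have "x \<notin> ball 0 T"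
        using x ballD opD by (auto simp: frontier_def interior_open)
      ultimately show "x \<in> fatou_set f" unfolding Z_def julia_set_def by blast
    qed
    moreover have "bounded D" using DS bounded_ball bounded_subset by blast
    moreover have "connected (frontier D)"
      by (rule connected_frontier_component_complement[OF _ compD]) (simp add: V(3) connected_imp_connected_closure)
    moreover have "\<alpha> \<in> D \<inter> julia_set f" using ballD T(1) julia by auto
    ultimately show False
      using connected_fatou_frontier_impossible[OF opD _ _ order_refl] compact_frontier_bounded by blast
  qed
  then show ?thesis using that[OF compL connL sphL] LZ unfolding Z_def by blast
qed

text \<open>A bounded complementary component of \<open>G\<close> would contain Julia points. It can
  be enclosed in a domain with frontier in \<open>G\<close>, whose outer frontier is then a Fatou
  continuum around Julia points.\<close>

lemma bounded_fatou_domain_simply_connected: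
  assumes G: "open G" "connected G" "bounded G" "G \<subseteq> fatou_set f" "frontier G \<subseteq> julia_set f"
  shows "simply_connected G"
  unfolding simply_connected_eq_unbounded_complement_components[OF G(1)]
proof (intro conjI ballI notI)
  show "connected G" by fact
  fix C assume C: "C \<in> components (- G)" "bounded C"
  have clG: "closed (- G)" using G(1) by blast
  have clC: "closed C" using closed_components[OF clG C(1)] .
  then have compC: "compact C" using C(2) compact_eq_bounded_closed by blast
  obtain V where V: "open V" "bounded V" "connected V" "C \<subseteq> V" "frontier V \<inter> - G = {}"
    using component_enclosing_domain[OF clG C(1) compC open_UNIV] by auto
  have "C \<noteq> {}" "C \<noteq> UNIV" using C in_components_nonempty by auto
  then have "frontier C \<noteq> {}" by (simp add: frontier_eq_empty)
  moreover have "frontier C \<subseteq> C" using clC frontier_subset_eq by blast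
  moreover have "frontier C \<subseteq> julia_set f"
    using frontier_of_components_subset[OF C(1)] G(5) by (simp add: frontier_complement)
  ultimately have VJ: "V \<inter> julia_set f \<noteq> {}" using V(4) by blast
  define Q where "Q = outside (closure V)"
  have bcl: "bounded (closure V)" using V(2) by (rule bounded_closure)
  have Qc: "Q \<in> components (- closure V)" unfolding Q_def
    using outside_in_components outside_bounded_nonempty[OF bcl] connected_outside[OF bcl] by auto
  \<comment> \<open>Taking the closure first makes \<open>D\<close> open; its frontier can only
    shrink, so it stays in the connected set \<open>frontier Q\<close>.\<close>
  define D where "D = - closure Q"
  have VD: "V \<subseteq> D"
  proof -
    have "V \<inter> Q = {}" using in_components_subset[OF Qc] closure_subset[of V] by blast
    then have "V \<inter> closure Q = {}" using V(1) open_Int_closure_eq_empty by blast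
    then show ?thesis unfolding D_def by blast
  qed
  have "bounded (- Q)" using cobounded_outside[OF bcl] by (simp add: Q_def)
  then have bD: "bounded D" unfolding D_def using bounded_subset closure_subset by (metis compl_mono)
  have frQ: "frontier Q \<subseteq> G"
  proof -
    have "frontier Q \<subseteq> frontier (closure V)"
      using frontier_of_components_subset[OF Qc] by (simp add: frontier_complement)
    then show ?thesis using frontier_closure_subset[of V] V(5) by blast
  qed
  have frD: "frontier D \<subseteq> frontier Q"
    unfolding D_def frontier_complement by (rule frontier_closure_subset)
  have bQ: "bounded (frontier Q)" using frQ G(3) bounded_subset by blast
  show False
  proof (rule connected_fatou_frontier_impossible)
    show "open D" unfolding D_def by auto
    show "bounded D" by fact
    show "D \<inter> julia_set f \<noteq> {}" using VJ VD by blast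
    show "frontier D \<subseteq> frontier Q" by fact
    show "compact (frontier Q)" using bQ by (simp add: compact_eq_bounded_closed)
    show "connected (frontier Q)"
      by (rule connected_frontier_component_complement[OF _ Qc]) (simp add: V(3) connected_imp_connected_closure)
    show "frontier Q \<subseteq> fatou_set f" using frQ G(4) by blast
  qed
qed

end

section \<open>Harmonic measure\<close>

text \<open>Normalised arc length on circles, transported to the parameter of
  \<open>circlepath\<close>.\<close>

abbreviation unit_interval_measure :: "real measure" where
  "unit_interval_measure \<equiv> lebesgue_on {0..1}"

lemma integrable_unit_interval:
  fixes f :: "real \<Rightarrow> 'a::euclidean_space"
  assumes "continuous_on {0..1} f"
  shows "integrable unit_interval_measure f"
  using continuous_imp_integrable[of 0 1 f] assms by simp

lemma unit_interval_measure_finite: "finite_measure unit_interval_measure"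
  by (rule finite_measure_lebesgue_on) simp

lemma continuous_on_circlepath_compose:
  assumes "h holomorphic_on ball 0 R" "0 < \<rho>" "\<rho> < R"
  shows "continuous_on {0..1} (\<lambda>t. h (circlepath 0 \<rho> t))"
proof (rule continuous_on_compose2[OF holomorphic_on_imp_continuous_on[OF assms(1)]])
  show "continuous_on {0..1} (circlepath 0 \<rho>)" unfolding circlepath by (intro continuous_intros)
  show "circlepath 0 \<rho> ` {0..1} \<subseteq> ball 0 R" using assms by (auto simp: circlepath norm_mult)
qed

lemma mean_value_circlepath:
  assumes h: "h holomorphic_on ball 0 R" and \<rho>: "0 < \<rho>" "\<rho> < R"
  shows "(LINT t|unit_interval_measure. h (circlepath 0 \<rho> t)) = h 0"
proof -
  have "((\<lambda>w. h w / (w - 0)) has_contour_integral (2 * of_real pi * \<i> * h 0)) (circlepath 0 \<rho>)"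
    by (rule Cauchy_integral_circlepath_simple) (use \<rho> in \<open>auto intro!: holomorphic_on_subset[OF h]\<close>)
  then have "((\<lambda>t. h (circlepath 0 \<rho> t) / circlepath 0 \<rho> t * vector_derivative (circlepath 0 \<rho>) (at t within {0..1}))
       has_integral (2 * of_real pi * \<i> * h 0)) {0..1}"
    by (simp add: has_contour_integral_def)
  then have "((\<lambda>t. 2 * of_real pi * \<i> * h (circlepath 0 \<rho> t)) has_integral (2 * of_real pi * \<i> * h 0)) {0..1}"
  proof (rule has_integral_eq[rotated])
    fix t :: real assume "t \<in> {0..1}"
    then have v: "vector_derivative (circlepath 0 \<rho>) (at t within {0..1}) = 2 * pi * \<i> * \<rho> * exp (2 * of_real pi * \<i> * t)"
      by (intro vector_derivative_circlepath01) auto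
    show "h (circlepath 0 \<rho> t) / circlepath 0 \<rho> t * vector_derivative (circlepath 0 \<rho>) (at t within {0..1}) =
        2 * of_real pi * \<i> * h (circlepath 0 \<rho> t)"
      unfolding v using \<rho> by (simp add: circlepath)
  qed
  then have "((\<lambda>t. h (circlepath 0 \<rho> t)) has_integral h 0) {0..1}"
    using has_integral_mult_right[of "\<lambda>t. 2 * of_real pi * \<i> * h (circlepath 0 \<rho> t)" "2 * of_real pi * \<i> * h 0" "{0..1}"
        "inverse (2 * of_real pi * \<i>)"] by (simp add: field_simps)
  moreover have "integrable unit_interval_measure (\<lambda>t. h (circlepath 0 \<rho> t))"
    by (intro integrable_unit_interval continuous_on_circlepath_compose[OF h \<rho>])
  ultimately show ?thesis
    by (simp add: lebesgue_integral_eq_integral integral_unique)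
qed

text \<open>With \<open>g = exp h\<close> on the disc, \<open>- Re h\<close> is nonnegative and
  harmonic with mean \<open>- ln (norm (g 0))\<close>, so this is Markov's inequality at level
  \<open>- ln \<tau>\<close>. The right-hand side is a quotient of two logarithms, neither of them
  positive.\<close>

lemma measure_small_values_circle:
  assumes g: "g holomorphic_on ball 0 1" "\<And>z. z \<in> ball 0 1 \<Longrightarrow> g z \<noteq> 0 \<and> norm (g z) \<le> 1"
    and \<rho>: "0 < \<rho>" "\<rho> < 1" and \<tau>: "0 < \<tau>" "\<tau> < 1"
  shows "measure unit_interval_measure {t \<in> {0..1}. norm (g (circlepath 0 \<rho> t)) \<le> \<tau>} \<le> ln (norm (g 0)) / ln \<tau>"
proof -
  have "simply_connected (ball (0::complex) 1)" by (simp add: convex_imp_simply_connected)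
  then obtain h where h: "h holomorphic_on ball 0 1" "\<And>z. z \<in> ball 0 1 \<Longrightarrow> g z = exp (h z)"
    using simply_connected_eq_holomorphic_log[of "ball (0::complex) 1"] g by auto
  have ln_g: "ln (norm (g z)) = Re (h z)" if "z \<in> ball 0 1" for z
    using h(2)[OF that] by simp
  define u where "u = (\<lambda>t. - Re (h (circlepath 0 \<rho> t)))"
  have cb: "circlepath 0 \<rho> t \<in> ball 0 1" for t using \<rho> by (auto simp: circlepath norm_mult)
  have int_h: "integrable unit_interval_measure (\<lambda>t. h (circlepath 0 \<rho> t))"
    by (intro integrable_unit_interval continuous_on_circlepath_compose[OF h(1) \<rho>])
  then have int_u: "integrable unit_interval_measure u" unfolding u_def by (intro Bochner_Integration.integrable_minus integrable_Re)
  have "(LINT t|unit_interval_measure. u t) = - Re (h 0)"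
    using mean_value_circlepath[OF h(1) \<rho>] int_h unfolding u_def by (simp add: integral_Re[symmetric])
  also have "\<dots> = - ln (norm (g 0))" using ln_g[of 0] by simp
  finally have iu: "(LINT t|unit_interval_measure. u t) = - ln (norm (g 0))" .
  have u0: "u t \<ge> 0" for t
    using ln_g[OF cb[of t]] g(2)[OF cb[of t]] unfolding u_def by (metis ln_le_zero_iff neg_0_le_iff_le zero_less_norm_iff)
  have "measure unit_interval_measure {t \<in> space unit_interval_measure. u t \<ge> - ln \<tau>} \<le> (LINT t|unit_interval_measure. u t) / (- ln \<tau>)"
    by (rule integral_Markov_inequality_measure[OF int_u sets.top]) (use u0 \<tau> in auto)
  moreover have "{t \<in> {0..1}. norm (g (circlepath 0 \<rho> t)) \<le> \<tau>} = {t \<in> space unit_interval_measure. u t \<ge> - ln \<tau>}"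
  proof -
    have "norm (g (circlepath 0 \<rho> t)) \<le> \<tau> \<longleftrightarrow> u t \<ge> - ln \<tau>" for t
      using ln_g[OF cb[of t]] g(2)[OF cb[of t]] \<tau> unfolding u_def
      by (metis ln_le_cancel_iff neg_le_iff_le zero_less_norm_iff)
    then show ?thesis by auto
  qed
  ultimately show ?thesis using iu by simp
qed

section \<open>Parseval's identity and radial limits of bounded functions\<close>

lemma parseval_finite:
  fixes c :: "nat \<Rightarrow> complex"
  shows "(LINT t|unit_interval_measure. (norm (\<Sum>n<N. c n * circlepath 0 1 t ^ n))\<^sup>2) = (\<Sum>n<N. (norm (c n))\<^sup>2)"
proof (induction N)
  case (Suc N)
  define E where "E = (\<lambda>t. circlepath 0 1 t)"
  define S where "S = (\<lambda>t. \<Sum>n<N. c n * E t ^ n)"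
  \<comment> \<open>On the unit circle \<open>cnj (E t)\<close> is the inverse of
    \<open>E t\<close>, so the cross term is the polynomial \<open>h\<close> at \<open>E t\<close>.
    All its exponents are positive, so its mean \<open>h 0\<close> is 0.\<close>
  define h where "h = (\<lambda>z::complex. c N * (\<Sum>n<N. cnj (c n) * z ^ (N - n)))"
  have nE: "norm (E t) = 1" for t by (simp add: E_def circlepath)
  have EE: "E t * cnj (E t) = 1" for t using nE[of t] complex_norm_square[of "E t"] by simp
  have cross: "c N * E t ^ N * cnj (S t) = h (E t)" for t
  proof -
    have "E t ^ N * cnj (E t ^ n) = E t ^ (N - n)" if "n < N" for n
    proof -
      have "E t ^ N = E t ^ (N - n) * E t ^ n" using that by (simp flip: power_add)
      then show ?thesis using EE[of t] by (simp flip: power_mult_distrib add: mult.assoc)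
    qed
    then show ?thesis unfolding S_def h_def by (auto simp: sum_distrib_left mult_ac intro!: sum.cong)
  qed
  have "norm (S t + c N * E t ^ N) ^ 2 = norm (S t) ^ 2 + norm (c N) ^ 2 + 2 * Re (h (E t))" for t
  proof -
    have "norm (S t + c N * E t ^ N) ^ 2 = norm (S t) ^ 2 + norm (c N * E t ^ N) ^ 2 + 2 * Re (c N * E t ^ N * cnj (S t))"
      unfolding cmod_power2 by (simp add: power2_eq_square algebra_simps)
    then show ?thesis using nE[of t] unfolding cross by (simp add: norm_mult norm_power)
  qed
  moreover have "continuous_on {0..1} E" unfolding E_def circlepath by (intro continuous_intros)
  then have "integrable unit_interval_measure (\<lambda>t. norm (S t) ^ 2)" "integrable unit_interval_measure (\<lambda>t. h (E t))"
    by (auto intro!: integrable_unit_interval continuous_intros simp: S_def h_def)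
  moreover have "(LINT t|unit_interval_measure. h (E t)) = h 0"
    unfolding E_def by (rule mean_value_circlepath[of h 2]) (auto intro!: holomorphic_intros simp: h_def)
  moreover have "h 0 = 0" by (auto simp: h_def intro!: sum.neutral)
  moreover have "measure unit_interval_measure (space unit_interval_measure) = 1"
    by (simp add: measure_restrict_space)
  ultimately show ?case
    using Suc unfolding S_def E_def
    by (simp add: integral_Re finite_measure.integrable_const[OF unit_interval_measure_finite])
qed simp

lemma parseval:
  fixes c :: "nat \<Rightarrow> complex"
  assumes "summable (\<lambda>n. norm (c n))"
  shows "(\<lambda>n. (norm (c n))\<^sup>2) sums (LINT t|unit_interval_measure. (norm (\<Sum>n. c n * circlepath 0 1 t ^ n))\<^sup>2)"
proof -
  define E where "E = (\<lambda>t. circlepath 0 1 t)"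
  define C where "C = (\<Sum>n. norm (c n))"
  have nE: "norm (E t) = 1" for t by (simp add: E_def circlepath)
  have contE: "continuous_on {0..1} E" unfolding E_def circlepath by (intro continuous_intros)
  have sm: "summable (\<lambda>n. c n * E t ^ n)" for t
    by (rule summable_norm_cancel) (use assms nE in \<open>simp add: norm_mult norm_power\<close>)
  have lim: "(\<lambda>N. (norm (\<Sum>n<N. c n * E t ^ n))\<^sup>2) \<longlonglongrightarrow> (norm (\<Sum>n. c n * E t ^ n))\<^sup>2" for t
    by (intro tendsto_intros summable_LIMSEQ sm)
  have bnd: "norm ((norm (\<Sum>n<N. c n * E t ^ n))\<^sup>2) \<le> C\<^sup>2" for N t
  proof -
    have "norm (\<Sum>n<N. c n * E t ^ n) \<le> (\<Sum>n<N. norm (c n * E t ^ n))" by (rule norm_sum)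
    also have "\<dots> = (\<Sum>n<N. norm (c n))" using nE by (simp add: norm_mult norm_power)
    also have "\<dots> \<le> C" unfolding C_def by (rule sum_le_suminf[OF assms]) auto
    finally show ?thesis by (simp add: power_mono)
  qed
  have meas: "(\<lambda>t. (norm (\<Sum>n<N. c n * E t ^ n))\<^sup>2) \<in> borel_measurable unit_interval_measure" for N
    by (intro borel_measurable_integrable integrable_unit_interval continuous_intros contE)
  have "(\<lambda>N. LINT t|unit_interval_measure. (norm (\<Sum>n<N. c n * E t ^ n))\<^sup>2)
      \<longlonglongrightarrow> (LINT t|unit_interval_measure. (norm (\<Sum>n. c n * E t ^ n))\<^sup>2)"
  proof (rule integral_dominated_convergence[where w = "\<lambda>_. C\<^sup>2"])
    show "(\<lambda>t. (norm (\<Sum>n. c n * E t ^ n))\<^sup>2) \<in> borel_measurable unit_interval_measure"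
      by (rule borel_measurable_LIMSEQ_metric[OF meas lim])
    show "integrable unit_interval_measure (\<lambda>_. C\<^sup>2)"
      by (rule finite_measure.integrable_const[OF unit_interval_measure_finite])
  qed (use meas lim bnd in auto)
  then show ?thesis unfolding E_def parseval_finite sums_def .
qed

text \<open>A weak form of Fatou's theorem, with radii depending on the function. Boundedness makes
  the Taylor coefficients square summable, so the restrictions to circles are Cauchy in mean square
  as the radius tends to 1. Along radii chosen fast enough the successive differences are summable
  almost everywhere.\<close>

lemma radial_limits_along_sequence:
  fixes \<phi> :: "complex \<Rightarrow> complex"
  assumes hol: "\<phi> holomorphic_on ball 0 1" and bdd: "\<And>z. z \<in> ball 0 1 \<Longrightarrow> norm (\<phi> z) \<le> B"
  obtains \<rho> :: "nat \<Rightarrow> real" where "\<And>j. 0 < \<rho> j" "\<And>j. \<rho> j < 1" "\<rho> \<longlonglongrightarrow> 1"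
    "AE t in unit_interval_measure. convergent (\<lambda>j. \<phi> (circlepath 0 (\<rho> j) t))"
proof -
  define a where "a = (\<lambda>n. (deriv ^^ n) \<phi> 0 / fact n)"
  have ser: "(\<lambda>n. a n * z ^ n) sums \<phi> z" if "z \<in> ball 0 1" for z
    using holomorphic_power_series[OF hol that] by (simp add: a_def)
  have asum: "summable (\<lambda>n. norm (a n) * s ^ n)" if s: "0 < s" "s < 1" for s :: real
  proof -
    define x where "x = (1 + s) / 2"
    have x: "s < x" "x < 1" "0 < x" using s by (auto simp: x_def)
    have "complex_of_real x \<in> ball 0 1" using x by simp
    from sums_summable[OF ser[OF this]]
    have "summable (\<lambda>n. norm (a n * of_real s ^ n))"
      by (rule powser_insidea) (use s x in auto)
    then show ?thesis using s by (simp add: norm_mult norm_power)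
  qed
  have circ: "circlepath 0 s t = of_real s * circlepath 0 1 t" for s t by (simp add: circlepath)
  have pars: "(\<lambda>n. (norm (a n))\<^sup>2 * (x ^ n - y ^ n)\<^sup>2) sums
      (LINT t|unit_interval_measure. (norm (\<phi> (circlepath 0 x t) - \<phi> (circlepath 0 y t)))\<^sup>2)"
    if x: "0 < x" "x < 1" and y: "0 < y" "y < 1" for x y
  proof -
    define c where "c = (\<lambda>n. a n * (of_real x ^ n - of_real y ^ n))"
    have nc: "norm (c n) = norm (a n) * \<bar>x ^ n - y ^ n\<bar>" for n
      unfolding c_def norm_mult by (metis norm_of_real of_real_diff of_real_power)
    have "summable (\<lambda>n. norm (c n))"
    proof (rule summable_comparison_test'[of "\<lambda>n. norm (a n) * x ^ n + norm (a n) * y ^ n" 0])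
      show "summable (\<lambda>n. norm (a n) * x ^ n + norm (a n) * y ^ n)" using asum x y by (intro summable_add)
      fix n
      have "\<bar>x ^ n - y ^ n\<bar> \<le> x ^ n + y ^ n" using x y by (simp add: abs_le_iff add_increasing add_increasing2)
      then show "norm (norm (c n)) \<le> norm (a n) * x ^ n + norm (a n) * y ^ n"
        unfolding nc by (simp flip: distrib_left add: mult_left_mono)
    qed
    from parseval[OF this] have "(\<lambda>n. (norm (c n))\<^sup>2) sums (LINT t|unit_interval_measure. (norm (\<Sum>n. c n * circlepath 0 1 t ^ n))\<^sup>2)" .
    moreover have "(\<Sum>n. c n * circlepath 0 1 t ^ n) = \<phi> (circlepath 0 x t) - \<phi> (circlepath 0 y t)" for t
    proof -
      have "circlepath 0 x t \<in> ball 0 1" "circlepath 0 y t \<in> ball 0 1" using x y by (auto simp: circlepath norm_mult)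
      from sums_diff[OF ser[OF this(1)] ser[OF this(2)]]
      have "(\<lambda>n. c n * circlepath 0 1 t ^ n) sums (\<phi> (circlepath 0 x t) - \<phi> (circlepath 0 y t))"
        unfolding circ[of x] circ[of y] c_def by (simp add: power_mult_distrib algebra_simps)
      then show ?thesis by (simp add: sums_iff)
    qed
    ultimately show ?thesis unfolding nc by (simp add: power_mult_distrib)
  qed
  have a2: "summable (\<lambda>n. (norm (a n))\<^sup>2)"
  proof (rule bounded_imp_summable[of _ "B\<^sup>2"])
    fix N
    have "(\<Sum>n\<le>N. (norm (a n))\<^sup>2 * (s ^ n)\<^sup>2) \<le> B\<^sup>2" if s: "0 < s" "s < 1" for s :: real
    proof -
      have cs: "summable (\<lambda>n. norm (a n * of_real s ^ n))"
        using asum[OF s] s by (simp add: norm_mult norm_power)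
      have eq: "(\<Sum>n. a n * of_real s ^ n * circlepath 0 1 t ^ n) = \<phi> (circlepath 0 s t)" for t
      proof -
        have "circlepath 0 s t \<in> ball 0 1" using s by (auto simp: circlepath norm_mult)
        from ser[OF this] show ?thesis unfolding circ[of s] by (simp add: sums_iff power_mult_distrib mult.assoc)
      qed
      from parseval[OF cs] have P: "(\<lambda>n. (norm (a n))\<^sup>2 * (s ^ n)\<^sup>2) sums (LINT t|unit_interval_measure. (norm (\<phi> (circlepath 0 s t)))\<^sup>2)"
        unfolding eq using s by (simp add: norm_mult norm_power power_mult_distrib)
      have "(\<Sum>n\<le>N. (norm (a n))\<^sup>2 * (s ^ n)\<^sup>2) \<le> (LINT t|unit_interval_measure. (norm (\<phi> (circlepath 0 s t)))\<^sup>2)"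
        using P sum_le_suminf[of "\<lambda>n. (norm (a n))\<^sup>2 * (s ^ n)\<^sup>2" "{..N}"] by (auto simp: sums_iff)
      also have "\<dots> \<le> (LINT t|unit_interval_measure. B\<^sup>2)"
      proof (rule integral_mono)
        show "integrable unit_interval_measure (\<lambda>t. (norm (\<phi> (circlepath 0 s t)))\<^sup>2)"
          by (intro integrable_unit_interval continuous_intros continuous_on_circlepath_compose[OF hol s])
        show "integrable unit_interval_measure (\<lambda>t. B\<^sup>2)"
          by (rule finite_measure.integrable_const[OF unit_interval_measure_finite])
        show "(norm (\<phi> (circlepath 0 s t)))\<^sup>2 \<le> B\<^sup>2" for t
          using s by (intro power_mono bdd) (auto simp: circlepath norm_mult)
      qed
      also have "\<dots> = B\<^sup>2" by (simp add: measure_restrict_space)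
      finally show ?thesis .
    qed
    then have "\<forall>\<^sub>F s in at_left 1. (\<Sum>n\<le>N. (norm (a n))\<^sup>2 * (s ^ n)\<^sup>2) \<le> B\<^sup>2"
      using eventually_at_left_real[of 0 1] by (auto elim!: eventually_mono)
    moreover have "((\<lambda>s::real. \<Sum>n\<le>N. (norm (a n))\<^sup>2 * (s ^ n)\<^sup>2) \<longlongrightarrow> (\<Sum>n\<le>N. (norm (a n))\<^sup>2 * (1 ^ n)\<^sup>2)) (at_left 1)"
      by (intro tendsto_intros)
    ultimately show "(\<Sum>n\<le>N. (norm (a n))\<^sup>2) \<le> B\<^sup>2"
      using tendsto_upperbound[of _ _ "at_left (1::real)" "B\<^sup>2"] by fastforce
  qed auto
  \<comment> \<open>Both \<open>x ^ n\<close> and \<open>s ^ n\<close> lie between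
    \<open>y ^ n\<close> and 1. So the first \<open>N\<close> terms are small for \<open>y\<close>
    near 1, and the remaining ones are below the tail of \<open>a2\<close>.\<close>
  have small: "\<exists>y<1. 0 < y \<and> (\<forall>s x. y \<le> s \<longrightarrow> s < 1 \<longrightarrow> s \<le> x \<longrightarrow> x < 1 \<longrightarrow>
      (LINT t|unit_interval_measure. (norm (\<phi> (circlepath 0 x t) - \<phi> (circlepath 0 s t)))\<^sup>2) \<le> e)"
    if e: "e > 0" for e :: real
  proof -
    obtain N where N: "(\<Sum>n. (norm (a (n + N)))\<^sup>2) < e / 2"
      using suminf_exist_split[OF _ a2, of "e/2"] e by (metis abs_of_nonneg half_gt_zero order_refl real_norm_def suminf_nonneg summable_ignore_initial_segment[OF a2] zero_le_power2)
    have "((\<lambda>y::real. \<Sum>n<N. (norm (a n))\<^sup>2 * (1 - y ^ n)\<^sup>2) \<longlongrightarrow> (\<Sum>n<N. (norm (a n))\<^sup>2 * (1 - 1 ^ n)\<^sup>2)) (at_left 1)"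
      by (intro tendsto_intros)
    then have "\<forall>\<^sub>F y in at_left 1. (\<Sum>n<N. (norm (a n))\<^sup>2 * (1 - y ^ n)\<^sup>2) < e / 2"
      using e by (intro order_tendstoD) auto
    moreover have "\<forall>\<^sub>F y::real in at_left 1. y \<in> {0<..<1}" by (rule eventually_at_left_real) simp
    ultimately have "\<forall>\<^sub>F y in at_left 1. (\<Sum>n<N. (norm (a n))\<^sup>2 * (1 - y ^ n)\<^sup>2) < e / 2 \<and> y \<in> {0<..<1}"
      by (rule eventually_conj)
    then obtain y where y: "(\<Sum>n<N. (norm (a n))\<^sup>2 * (1 - y ^ n)\<^sup>2) < e / 2" "0 < y" "y < 1"
      using eventually_happens'[OF trivial_limit_at_left_real] by force
    have "(LINT t|unit_interval_measure. (norm (\<phi> (circlepath 0 x t) - \<phi> (circlepath 0 s t)))\<^sup>2) \<le> e"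
      if s: "y \<le> s" "s < 1" "s \<le> x" "x < 1" for s x
    proof -
      have pos: "0 < s" "0 < x" using s y by auto
      have le: "(x ^ n - s ^ n)\<^sup>2 \<le> (1 - y ^ n)\<^sup>2" for n
      proof (rule power_mono)
        have "x ^ n \<le> 1" using pos s by (simp add: power_le_one)
        moreover have "y ^ n \<le> s ^ n" using y s by (simp add: power_mono)
        ultimately show "x ^ n - s ^ n \<le> 1 - y ^ n" by simp
        show "0 \<le> x ^ n - s ^ n" using pos s by (simp add: power_mono)
      qed
      have le1: "(x ^ n - s ^ n)\<^sup>2 \<le> 1" for n
      proof -
        have "(1 - y ^ n)\<^sup>2 \<le> 1" using y by (intro power_le_one) (auto simp: power_le_one)
        then show ?thesis using le[of n] by linarith
      qed
      note P = pars[OF pos(2) s(4) pos(1) s(2)]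
      have "(LINT t|unit_interval_measure. (norm (\<phi> (circlepath 0 x t) - \<phi> (circlepath 0 s t)))\<^sup>2)
          = (\<Sum>n. (norm (a n))\<^sup>2 * (x ^ n - s ^ n)\<^sup>2)" using P by (simp add: sums_iff)
      also have "\<dots> = (\<Sum>n. (norm (a (n + N)))\<^sup>2 * (x ^ (n + N) - s ^ (n + N))\<^sup>2) + (\<Sum>n<N. (norm (a n))\<^sup>2 * (x ^ n - s ^ n)\<^sup>2)"
        using P by (intro suminf_split_initial_segment) (simp add: sums_iff)
      also have "\<dots> \<le> (\<Sum>n. (norm (a (n + N)))\<^sup>2) + (\<Sum>n<N. (norm (a n))\<^sup>2 * (1 - y ^ n)\<^sup>2)"
      proof (intro add_mono suminf_le sum_mono mult_left_mono le)
        show "(norm (a (n + N)))\<^sup>2 * (x ^ (n + N) - s ^ (n + N))\<^sup>2 \<le> (norm (a (n + N)))\<^sup>2" for n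
          using mult_left_mono[OF le1[of "n + N"], of "(norm (a (n + N)))\<^sup>2"] by simp
        show "summable (\<lambda>n. (norm (a (n + N)))\<^sup>2 * (x ^ (n + N) - s ^ (n + N))\<^sup>2)"
          using P summable_ignore_initial_segment[of "\<lambda>n. (norm (a n))\<^sup>2 * (x ^ n - s ^ n)\<^sup>2" N] by (simp add: sums_iff)
        show "summable (\<lambda>n. (norm (a (n + N)))\<^sup>2)" using a2 by (rule summable_ignore_initial_segment)
      qed auto
      also have "\<dots> \<le> e" using N y(1) by linarith
      finally show ?thesis .
    qed
    then show ?thesis using y(2,3) by blast
  qed
  have "\<forall>k::nat. \<exists>y<1. 0 < y \<and> (\<forall>s x. y \<le> s \<longrightarrow> s < 1 \<longrightarrow> s \<le> x \<longrightarrow> x < 1 \<longrightarrow>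
      (LINT t|unit_interval_measure. (norm (\<phi> (circlepath 0 x t) - \<phi> (circlepath 0 s t)))\<^sup>2) \<le> (1/16) ^ k)"
    by (intro allI small) simp
  from choice[OF this] obtain y where y: "\<And>k. y k < 1" "\<And>k. 0 < y k"
    and yI: "\<And>k s x. y k \<le> s \<Longrightarrow> s < 1 \<Longrightarrow> s \<le> x \<Longrightarrow> x < 1 \<Longrightarrow>
      (LINT t|unit_interval_measure. (norm (\<phi> (circlepath 0 x t) - \<phi> (circlepath 0 s t)))\<^sup>2) \<le> (1/16) ^ k"
    by blast
  \<comment> \<open>The maximum over all earlier thresholds makes the radii monotone; the first
    entry forces them to tend to 1.\<close>
  define \<rho> where "\<rho> = (\<lambda>j. max (1 - 1 / real (j + 2)) (Max (y ` {..j})))"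
  have \<rho>1: "\<rho> j < 1" for j unfolding \<rho>_def using y(1) by auto
  have \<rho>ge: "1 - 1 / real (j + 2) \<le> \<rho> j" "y j \<le> \<rho> j" for j
    unfolding \<rho>_def using Max_ge[of "y ` {..j}" "y j"] by (auto simp: le_max_iff_disj)
  have \<rho>0: "0 < \<rho> j" for j using \<rho>ge(2)[of j] y(2)[of j] by linarith
  have \<rho>S: "\<rho> j \<le> \<rho> (Suc j)" for j
  proof -
    have "1 - 1 / real (j + 2) \<le> 1 - 1 / real (Suc j + 2)" by (simp add: field_simps)
    moreover have "Max (y ` {..j}) \<le> Max (y ` {..Suc j})" by (intro Max_mono) auto
    ultimately show ?thesis unfolding \<rho>_def by (meson max.mono)
  qed
  have \<rho>lim: "\<rho> \<longlonglongrightarrow> 1"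
  proof (rule tendsto_sandwich[of "\<lambda>j. 1 - 1 / real (j + 2)" _ _ "\<lambda>_. 1"])
    have "(\<lambda>j. 1 / real (j + 2)) \<longlonglongrightarrow> 0"
      using LIMSEQ_ignore_initial_segment[OF lim_1_over_n, of 2] by simp
    from tendsto_diff[OF tendsto_const[of 1] this] show "(\<lambda>j. 1 - 1 / real (j + 2)) \<longlonglongrightarrow> 1" by simp
  qed (use \<rho>ge \<rho>1 in \<open>auto intro!: always_eventually less_imp_le\<close>)
  define d where "d = (\<lambda>j t. norm (\<phi> (circlepath 0 (\<rho> (Suc j)) t) - \<phi> (circlepath 0 (\<rho> j) t)))"
  have contd: "continuous_on {0..1} (d j)" for j
    unfolding d_def by (intro continuous_intros continuous_on_circlepath_compose[OF hol \<rho>0 \<rho>1])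
  have intd: "integrable unit_interval_measure (d j)" "integrable unit_interval_measure (\<lambda>t. (d j t)\<^sup>2)" for j
    using contd by (auto intro!: integrable_unit_interval continuous_intros)
  have d2: "(LINT t|unit_interval_measure. (d j t)\<^sup>2) \<le> (1/16) ^ j" for j
    unfolding d_def by (rule yI[OF \<rho>ge(2) \<rho>1 \<rho>S \<rho>1])
  have d1: "(LINT t|unit_interval_measure. d j t) \<le> (1/2) ^ j" for j
  proof -
    \<comment> \<open>The weighted arithmetic-geometric mean inequality passes from the square to
      the first power. The factor \<open>2 ^ j\<close> is absorbed by the bound
      \<open>(1/16) ^ j\<close>.\<close>
    have "(LINT t|unit_interval_measure. d j t) \<le> (LINT t|unit_interval_measure. ((1/2) ^ j + 2 ^ j * (d j t)\<^sup>2) / 2)"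
    proof (rule integral_mono)
      fix t
      have "0 \<le> ((1/2) ^ j - d j t)\<^sup>2" by simp
      then have "2 * ((1/2) ^ j * d j t) \<le> (1/2) ^ j * (1/2) ^ j + (d j t)\<^sup>2" by (simp add: power2_eq_square algebra_simps)
      then have "2 ^ j * (2 * ((1/2) ^ j * d j t)) \<le> 2 ^ j * ((1/2) ^ j * (1/2) ^ j + (d j t)\<^sup>2)" by (intro mult_left_mono) auto
      then show "d j t \<le> ((1/2) ^ j + 2 ^ j * (d j t)\<^sup>2) / 2"
        by (simp add: algebra_simps power_divide)
    qed (use intd in \<open>auto intro!: finite_measure.integrable_const[OF unit_interval_measure_finite]\<close>)
    also have "\<dots> = ((1/2) ^ j + 2 ^ j * (LINT t|unit_interval_measure. (d j t)\<^sup>2)) / 2"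
      using intd(2)[of j] by (simp add: finite_measure.integrable_const[OF unit_interval_measure_finite] measure_restrict_space)
    also have "\<dots> \<le> ((1/2) ^ j + 2 ^ j * (1/16) ^ j) / 2" using d2[of j] by simp
    also have "\<dots> \<le> (1/2) ^ j"
    proof -
      have "2 ^ j * (1/16::real) ^ j = (1/8) ^ j" by (simp flip: power_mult_distrib)
      also have "\<dots> \<le> (1/2) ^ j" by (intro power_mono) auto
      finally show ?thesis by simp
    qed
    finally show ?thesis .
  qed
  have "(\<integral>\<^sup>+t. (\<Sum>j. ennreal (d j t)) \<partial>unit_interval_measure) = (\<Sum>j. \<integral>\<^sup>+t. ennreal (d j t) \<partial>unit_interval_measure)"
    using intd(1) by (intro nn_integral_suminf) auto
  also have "\<dots> \<le> (\<Sum>j. ennreal ((1/2) ^ j))"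
  proof (intro suminf_le)
    fix j
    have "(\<integral>\<^sup>+t. ennreal (d j t) \<partial>unit_interval_measure) = ennreal (LINT t|unit_interval_measure. d j t)"
      using intd(1)[of j] by (intro nn_integral_eq_integral) (auto simp: d_def)
    then show "(\<integral>\<^sup>+t. ennreal (d j t) \<partial>unit_interval_measure) \<le> ennreal ((1/2) ^ j)"
      using d1[of j] by (simp add: ennreal_leI)
  qed auto
  also have "\<dots> = ennreal (\<Sum>j. (1/2) ^ j)" by (intro suminf_ennreal2) (auto simp: summable_geometric)
  finally have "(\<integral>\<^sup>+t. (\<Sum>j. ennreal (d j t)) \<partial>unit_interval_measure) \<noteq> \<infinity>"
    using ennreal_less_top le_less_trans less_irrefl by (metis infinity_ennreal_def)
  then have "AE t in unit_interval_measure. (\<Sum>j. ennreal (d j t)) \<noteq> \<infinity>"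
    using intd(1) by (intro nn_integral_noteq_infinite) auto
  then have "AE t in unit_interval_measure. convergent (\<lambda>j. \<phi> (circlepath 0 (\<rho> j) t))"
  proof eventually_elim
    case (elim t)
    then have "summable (\<lambda>j. d j t)" by (intro summable_suminf_not_top) (auto simp: d_def)
    then have "summable (\<lambda>j. \<phi> (circlepath 0 (\<rho> (Suc j)) t) - \<phi> (circlepath 0 (\<rho> j) t))"
      unfolding d_def by (rule summable_norm_cancel)
    then have "convergent (\<lambda>n. \<Sum>j<n. \<phi> (circlepath 0 (\<rho> (Suc j)) t) - \<phi> (circlepath 0 (\<rho> j) t))"
      by (simp add: summable_iff_convergent)
    then have "convergent (\<lambda>n. \<phi> (circlepath 0 (\<rho> n) t) - \<phi> (circlepath 0 (\<rho> 0) t))"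
      unfolding sum_lessThan_telescope[of "\<lambda>n. \<phi> (circlepath 0 (\<rho> n) t)"] .
    from convergent_add[OF this convergent_const[of "\<phi> (circlepath 0 (\<rho> 0) t)"]] show ?case by simp
  qed
  then show ?thesis using that[OF \<rho>0 \<rho>1 \<rho>lim] by blast
qed

text \<open>\<open>X\<close> is the boundary value of a Riemann map of the disc onto \<open>G\<close> sending 0 to \<open>z0\<close>, so its
  distribution is the harmonic measure of \<open>G\<close> at \<open>z0\<close>; the bound is Markov's inequality for
  the positive harmonic function \<open>- ln \<bar>g\<bar>\<close>.\<close>

lemma harmonic_measure_bound:
  assumes G: "open G" "simply_connected G" "bounded G" "z0 \<in> G"
  obtains X where "X \<in> borel_measurable unit_interval_measure"
    "AE t in unit_interval_measure. X t \<in> frontier G"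
    "\<And>g Q \<tau>. g holomorphic_on G \<Longrightarrow> (\<And>z. z \<in> G \<Longrightarrow> g z \<noteq> 0 \<and> norm (g z) \<le> 1) \<Longrightarrow> open Q \<Longrightarrow>
       0 < \<tau> \<Longrightarrow> \<tau> < 1 \<Longrightarrow> (\<And>z. z \<in> G \<inter> Q \<Longrightarrow> norm (g z) \<le> \<tau>) \<Longrightarrow>
       measure unit_interval_measure {t \<in> {0..1}. X t \<in> Q} \<le> ln (norm (g z0)) / ln \<tau>"
proof -
  have "G \<noteq> {}" "G \<noteq> UNIV" using G by auto
  then obtain F0 \<phi>0 where F0: "F0 holomorphic_on G" "\<And>z. z \<in> G \<Longrightarrow> F0 z \<in> ball 0 1 \<and> \<phi>0 (F0 z) = z"
    and \<phi>0: "\<phi>0 holomorphic_on ball 0 1" "\<And>z. z \<in> ball 0 1 \<Longrightarrow> \<phi>0 z \<in> G \<and> F0 (\<phi>0 z) = z"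
    using G(2) simply_connected_eq_biholomorphic_to_disc[OF G(1)] by metis
  define a where "a = F0 z0"
  have a: "norm a < 1" using F0(2)[OF G(4)] by (simp add: a_def)
  \<comment> \<open>The Moebius map normalises the Riemann map so that 0 goes to
    \<open>z0\<close>.\<close>
  define \<phi> where "\<phi> = \<phi>0 \<circ> Moebius_function 0 (- a)"
  define F where "F = Moebius_function 0 a \<circ> F0"
  have mb: "Moebius_function 0 (- a) z \<in> ball 0 1" if "z \<in> ball 0 1" for z
    using Moebius_function_norm_lt_1[of "- a" z 0] a that by simp
  have hol: "\<phi> holomorphic_on ball 0 1" unfolding \<phi>_def
  proof (rule holomorphic_on_compose_gen[OF _ \<phi>0(1)])
    show "Moebius_function 0 (- a) holomorphic_on ball 0 1" using a by (intro Moebius_function_holomorphic) simp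
  qed (use mb in auto)
  have \<phi>G: "\<phi> z \<in> G" if "z \<in> ball 0 1" for z using \<phi>0(2) mb[OF that] by (simp add: \<phi>_def)
  have F\<phi>: "F (\<phi> z) = z" if "z \<in> ball 0 1" for z
    using \<phi>0(2)[OF mb[OF that]] Moebius_function_compose[of a "- a" z] a that by (simp add: F_def \<phi>_def)
  have \<phi>z0: "\<phi> 0 = z0" using F0(2)[OF G(4)] by (simp add: \<phi>_def Moebius_function_of_zero a_def)
  have contF: "continuous_on G F" unfolding F_def
    by (rule continuous_on_compose[OF holomorphic_on_imp_continuous_on[OF F0(1)]])
       (use a F0(2) in \<open>auto intro!: holomorphic_on_imp_continuous_on[THEN continuous_on_subset, OF Moebius_function_holomorphic]\<close>)
  have Flt: "norm (F z) < 1" if "z \<in> G" for z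
    using Moebius_function_norm_lt_1[of a "F0 z" 0] a F0(2)[OF that] by (simp add: F_def)
  obtain B where B: "\<And>z. z \<in> G \<Longrightarrow> norm z \<le> B" using G(3) unfolding bounded_iff by blast
  obtain \<rho> :: "nat \<Rightarrow> real" where \<rho>: "\<And>j. 0 < \<rho> j" "\<And>j. \<rho> j < 1" "\<rho> \<longlonglongrightarrow> 1"
    and conv: "AE t in unit_interval_measure. convergent (\<lambda>j. \<phi> (circlepath 0 (\<rho> j) t))"
    using radial_limits_along_sequence[OF hol, of B] B \<phi>G by metis
  define Y where "Y = (\<lambda>j t. \<phi> (circlepath 0 (\<rho> j) t))"
  have circ: "circlepath 0 (\<rho> j) t \<in> ball 0 1" "norm (circlepath 0 (\<rho> j) t) = \<rho> j" for j t
    using \<rho>(1,2)[of j] by (auto simp: circlepath norm_mult)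
  have Ym: "Y j \<in> borel_measurable unit_interval_measure" for j unfolding Y_def
    by (intro borel_measurable_integrable integrable_unit_interval continuous_on_circlepath_compose[OF hol \<rho>(1,2)])
  have YG: "Y j t \<in> G" for j t unfolding Y_def using \<phi>G circ by blast
  define X where "X = (\<lambda>t. lim (\<lambda>j. Y j t))"
  have Xm: "X \<in> borel_measurable unit_interval_measure" unfolding X_def
    by (rule borel_measurable_lim_metric) (rule Ym)
  have XY: "AE t in unit_interval_measure. (\<lambda>j. Y j t) \<longlonglongrightarrow> X t"
    using conv unfolding X_def Y_def by (simp add: convergent_LIMSEQ_iff)
  show ?thesis
  proof
    show "X \<in> borel_measurable unit_interval_measure" by fact
    show "AE t in unit_interval_measure. X t \<in> frontier G"
      using XY
    proof eventually_elim
      case (elim t)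
      have "X t \<in> closure G" using elim YG by (meson closure_sequential)
      \<comment> \<open>The inverse map \<open>F\<close> would be continuous at such a limit,
        whereas \<open>F (Y j t)\<close> has modulus \<open>\<rho> j\<close>, which tends to
        1.\<close>
      moreover have "X t \<notin> G"
      proof
        assume XG: "X t \<in> G"
        then have "isCont F (X t)" using contF G(1) by (simp add: continuous_on_eq_continuous_at)
        then have "(\<lambda>j. F (Y j t)) \<longlonglongrightarrow> F (X t)" using elim isCont_tendsto_compose by blast
        then have "(\<lambda>j. norm (F (Y j t))) \<longlonglongrightarrow> norm (F (X t))" by (rule tendsto_norm)
        moreover have "norm (F (Y j t)) = \<rho> j" for j using F\<phi>[OF circ(1)] circ(2) by (simp add: Y_def)
        ultimately have "norm (F (X t)) = 1" using \<rho>(3) LIMSEQ_unique by auto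
        then show False using Flt[OF XG] by simp
      qed
      ultimately show ?case using G(1) by (simp add: frontier_def interior_open)
    qed
    fix g :: "complex \<Rightarrow> complex" and Q :: "complex set" and \<tau> :: real
    assume g: "g holomorphic_on G" "\<And>z. z \<in> G \<Longrightarrow> g z \<noteq> 0 \<and> norm (g z) \<le> 1" and Q: "open Q"
      and \<tau>: "0 < \<tau>" "\<tau> < 1" and gQ: "\<And>z. z \<in> G \<inter> Q \<Longrightarrow> norm (g z) \<le> \<tau>"
    interpret finite_measure unit_interval_measure by (rule unit_interval_measure_finite)
    let ?b = "ln (norm (g z0)) / ln \<tau>"
    \<comment> \<open>As \<open>Q\<close> is open, \<open>X t \<in> Q\<close> puts almost every such
      \<open>t\<close> into some \<open>A N\<close>. Each \<open>A N\<close> is controlled on the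
      single circle of radius \<open>\<rho> N\<close>, and the sets increase.\<close>
    define A where "A = (\<lambda>N. {t \<in> {0..1}. \<forall>j\<ge>N. Y j t \<in> Q})"
    have setY: "{t \<in> {0..1}. Y j t \<in> Q} \<in> sets unit_interval_measure" for j
      using measurable_sets[OF Ym[of j], of Q] Q by (simp add: vimage_def Int_def conj_commute)
    have setA: "A N \<in> sets unit_interval_measure" for N
    proof -
      have "A N = (\<Inter>j\<in>{N..}. {t \<in> {0..1}. Y j t \<in> Q})" unfolding A_def by auto
      then show ?thesis using setY by (simp only:) (intro sets.countable_INT, auto)
    qed
    have gh: "(\<lambda>z. g (\<phi> z)) holomorphic_on ball 0 1"
      using holomorphic_on_compose_gen[OF hol g(1)] \<phi>G by (simp add: o_def image_subset_iff)
    have mA: "measure unit_interval_measure (A N) \<le> ?b" for N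
    proof -
      have gY: "{t \<in> {0..1}. norm (g (\<phi> (circlepath 0 (\<rho> N) t))) \<le> \<tau>} \<in> sets unit_interval_measure"
      proof -
        have "(\<lambda>t. norm (g (\<phi> (circlepath 0 (\<rho> N) t)))) \<in> borel_measurable unit_interval_measure"
          by (intro borel_measurable_integrable integrable_unit_interval continuous_intros
              continuous_on_circlepath_compose[OF gh \<rho>(1,2)])
        from measurable_sets[OF this, of "{..\<tau>}"] show ?thesis by (simp add: vimage_def Int_def conj_commute)
      qed
      have "measure unit_interval_measure (A N) \<le> measure unit_interval_measure {t \<in> {0..1}. norm (g (\<phi> (circlepath 0 (\<rho> N) t))) \<le> \<tau>}"
        by (rule finite_measure_mono[OF _ gY]) (use gQ YG in \<open>auto simp: A_def Y_def\<close>)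
      also have "\<dots> \<le> ln (norm (g (\<phi> 0))) / ln \<tau>"
        by (rule measure_small_values_circle[OF gh _ \<rho>(1,2) \<tau>]) (use g(2) \<phi>G in auto)
      finally show ?thesis by (simp add: \<phi>z0)
    qed
    have "(\<lambda>N. measure unit_interval_measure (A N)) \<longlonglongrightarrow> measure unit_interval_measure (\<Union>N. A N)"
      by (rule finite_Lim_measure_incseq) (use setA in \<open>auto simp: incseq_def A_def\<close>)
    then have UA: "measure unit_interval_measure (\<Union>N. A N) \<le> ?b"
      by (rule LIMSEQ_le_const2) (use mA in auto)
    have "measure unit_interval_measure {t \<in> {0..1}. X t \<in> Q} \<le> measure unit_interval_measure (\<Union>N. A N)"
    proof (rule finite_measure_mono_AE)
      show "AE t in unit_interval_measure. t \<in> {t \<in> {0..1}. X t \<in> Q} \<longrightarrow> t \<in> (\<Union>N. A N)"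
        using XY
      proof eventually_elim
        case (elim t)
        show ?case
        proof
          assume t: "t \<in> {t \<in> {0..1}. X t \<in> Q}"
          then have "\<forall>\<^sub>F j in sequentially. Y j t \<in> Q" using topological_tendstoD[OF elim Q] by blast
          then show "t \<in> (\<Union>N. A N)" using t unfolding eventually_sequentially A_def by blast
        qed
      qed
    qed (use setA in auto)
    then show "measure unit_interval_measure {t \<in> {0..1}. X t \<in> Q} \<le> ?b" using UA by linarith
  qed
qed

section \<open>A barrier, and invariance of the bungee set\<close>

text \<open>Since \<open>q\<^sup>2 = w - c\<close>, the values \<open>q w\<close> and \<open>- q b\<close> can only be close if \<open>w\<close> is close to \<open>b\<close>,
  where \<open>q\<close> is the branch with \<open>q w / q b\<close> near 1. Hence \<open>(q - q b) / (q + q b)\<close> is bounded with absolute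
  constants and has its only zero at \<open>b\<close>.\<close>

lemma sqrt_barrier:
  assumes \<Omega>: "open \<Omega>" "simply_connected \<Omega>" "ball 0 T \<subseteq> \<Omega>" "c \<notin> \<Omega>" "norm c = T" and T: "T > 0"
    and b: "norm b \<le> T / 4"
  obtains u where "u holomorphic_on \<Omega>" "\<And>w. w \<in> \<Omega> \<Longrightarrow> w \<noteq> b \<Longrightarrow> u w \<noteq> 0" "\<And>w. w \<in> \<Omega> \<Longrightarrow> norm (u w) \<le> 9"
    "\<And>w. w \<in> \<Omega> \<Longrightarrow> norm (u w) \<le> 27 * norm (w - b) / T"
    "\<And>w. w \<in> \<Omega> \<Longrightarrow> 10 * T \<le> norm w \<Longrightarrow> 1/3 \<le> norm (u w)"
proof -
  obtain q where q: "q holomorphic_on \<Omega>" and q2: "\<And>w. w \<in> \<Omega> \<Longrightarrow> w - c = (q w)\<^sup>2"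
  proof -
    have "(\<lambda>w. w - c) holomorphic_on \<Omega> \<and> (\<forall>w\<in>\<Omega>. w - c \<noteq> 0)"
      using \<Omega>(4) by (auto intro!: holomorphic_intros)
    then show ?thesis using \<Omega>(2) that simply_connected_eq_holomorphic_sqrt[OF \<Omega>(1)] by blast
  qed
  define p where "p = q b"
  have b\<Omega>: "b \<in> \<Omega>" using \<Omega>(3) b T by auto
  have p2: "p\<^sup>2 = b - c" using q2[OF b\<Omega>] by (simp add: p_def)
  have np: "norm p ^ 2 = norm (b - c)" using p2 by (metis norm_power)
  have bc: "3 / 4 * T \<le> norm (b - c)" "norm (b - c) \<le> 5 / 4 * T"
    using norm_triangle_ineq4[of b c] norm_triangle_ineq2[of c b] b \<Omega>(5) by (auto simp: norm_minus_commute)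
  have pnz: "p \<noteq> 0" using np bc T by auto
  have diff: "(q w - p) * (q w + p) = w - b" if "w \<in> \<Omega>" for w
  proof -
    have "(q w - p) * (q w + p) = (q w)\<^sup>2 - p\<^sup>2" by (simp add: power2_eq_square algebra_simps)
    then show ?thesis by (simp add: p2 flip: q2[OF that])
  qed
  \<comment> \<open>Otherwise \<open>diff\<close> forces \<open>w\<close> to within 9/4 times 1/4 of
    \<open>norm (b - c)\<close> from \<open>b\<close>. On that disc the branch cannot change sign,
    so \<open>q w\<close> is nearer to \<open>p\<close> than to \<open>- p\<close>.\<close>
  have low: "norm p / 4 \<le> norm (q w + p)" if w: "w \<in> \<Omega>" for w
  proof (rule ccontr)
    assume "\<not> ?thesis"
    then have less: "norm (q w + p) < norm p / 4" by simp
    have "norm (q w - p) \<le> norm (q w + p) + 2 * norm p"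
      using norm_triangle_ineq4[of "q w + p" "2 * p"] by (simp add: norm_mult)
    then have "norm (q w - p) * norm (q w + p) \<le> (9 / 4 * norm p) * (norm p / 4)"
      using less by (intro mult_mono) auto
    then have "norm (w - b) \<le> 9 / 16 * norm p ^ 2"
      unfolding diff[OF w, symmetric] norm_mult by (simp add: power2_eq_square)
    then have wD: "norm (w - b) \<le> 9 / 16 * norm (b - c)" by (simp add: np)
    define D where "D = cball b (9 / 16 * norm (b - c))"
    have D\<Omega>: "D \<subseteq> \<Omega>"
    proof
      fix x assume "x \<in> D"
      then have "norm (x - b) \<le> 9 / 16 * norm (b - c)" by (simp add: D_def dist_norm norm_minus_commute)
      then have "norm x < T" using norm_triangle_ineq2[of x b] b bc T by linarith
      then show "x \<in> \<Omega>" using \<Omega>(3) by auto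
    qed
    define s where "s = (\<lambda>x. q x / p)"
    \<comment> \<open>The square of \<open>s x\<close> differs from 1 by at most 9/16, so it has
      positive real part and \<open>s x\<close> cannot be purely imaginary.\<close>
    have Re_s: "Re (s x) \<noteq> 0" if x: "x \<in> D" for x
    proof
      assume r0: "Re (s x) = 0"
      have "s x ^ 2 = (x - c) / (b - c)" using q2 D\<Omega> x by (auto simp: s_def power_divide p2)
      also have "\<dots> = 1 + (x - b) / (b - c)"
      proof -
        have "b - c \<noteq> 0" using bc T by auto
        then show ?thesis by (simp add: field_simps)
      qed
      finally have sx: "s x ^ 2 = 1 + (x - b) / (b - c)" .
      have "norm ((x - b) / (b - c)) \<le> 9 / 16"
        using x bc T by (simp add: D_def dist_norm norm_minus_commute norm_divide divide_simps)
      then have "Re ((x - b) / (b - c)) \<ge> - 9 / 16"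
        using abs_Re_le_cmod[of "(x - b) / (b - c)"] by linarith
      then have "Re (s x ^ 2) > 0" unfolding sx by simp
      moreover have "Re (s x ^ 2) \<le> 0" using r0 by (simp add: power2_eq_square)
      ultimately show False by simp
    qed
    have contD: "continuous_on D (\<lambda>x. Re (s x))"
      unfolding s_def using q D\<Omega> pnz
      by (intro continuous_intros) (auto intro: holomorphic_on_imp_continuous_on holomorphic_on_subset)
    have "connected ((\<lambda>x. Re (s x)) ` D)"
      by (rule connected_continuous_image[OF contD]) (simp add: D_def)
    moreover have wDD: "w \<in> D" using wD by (simp add: D_def dist_norm norm_minus_commute)
    moreover have bD: "b \<in> D" using bc T by (simp add: D_def)
    moreover have "Re (s b) = 1" using pnz by (simp add: s_def p_def)
    ultimately have "\<not> Re (s w) \<le> 0"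
      using connectedD_interval[of "(\<lambda>x. Re (s x)) ` D" "Re (s w)" "Re (s b)" 0] Re_s by force
    then have "1 < norm (s w + 1)" using complex_Re_le_cmod[of "s w + 1"] by simp
    moreover have "q w + p = p * (s w + 1)" using pnz by (simp add: s_def field_simps)
    ultimately have "norm p < norm (q w + p)" using pnz by (simp add: norm_mult)
    then show False using less norm_ge_zero[of p] by linarith
  qed
  have nz: "q w + p \<noteq> 0" if "w \<in> \<Omega>" for w using low[OF that] pnz by auto
  define u where "u = (\<lambda>w. (q w - p) / (q w + p))"
  show ?thesis
  proof
    show "u holomorphic_on \<Omega>" unfolding u_def using q nz by (intro holomorphic_intros) auto
    fix w assume w: "w \<in> \<Omega>"
    have pp: "norm p > 0" using pnz by simp
    show "u w \<noteq> 0" if "w \<noteq> b" using diff[OF w] nz[OF w] that by (auto simp: u_def)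
    \<comment> \<open>By \<open>low\<close>, \<open>2 * norm p\<close> is at most 8 times
      \<open>norm (q w + p)\<close>, which gives the constant 9.\<close>
    have "norm (q w - p) \<le> norm (q w + p) + 2 * norm p"
      using norm_triangle_ineq4[of "q w + p" "2 * p"] by (simp add: norm_mult)
    then have "norm (q w - p) \<le> 9 * norm (q w + p)" using low[OF w] by linarith
    then show "norm (u w) \<le> 9" unfolding u_def norm_divide using nz[OF w] by (simp add: divide_le_eq)
    have "norm (u w) = norm (w - b) / norm (q w + p) ^ 2"
      unfolding u_def diff[OF w, symmetric] norm_divide norm_mult using nz[OF w] by (simp add: power2_eq_square)
    also have "\<dots> \<le> norm (w - b) / (norm p / 4) ^ 2"
      using low[OF w] pp by (intro divide_left_mono power_mono mult_pos_pos) auto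
    also have "\<dots> = 16 * norm (w - b) / norm (b - c)" by (simp add: power_divide np)
    also have "\<dots> \<le> 16 * norm (w - b) / (3 / 4 * T)"
      using bc T by (intro divide_left_mono mult_pos_pos) auto
    also have "\<dots> \<le> 27 * norm (w - b) / T" using T by (simp add: field_simps)
    finally show "norm (u w) \<le> 27 * norm (w - b) / T" .
    \<comment> \<open>Here \<open>norm (w - c)\<close> is at least \<open>9 * T\<close>, more than 4
      times \<open>5 / 4 * T\<close>, so \<open>norm (q w)\<close> is at least twice
      \<open>norm p\<close>.\<close>
    show "1/3 \<le> norm (u w)" if far: "10 * T \<le> norm w"
    proof -
      have "norm (q w) ^ 2 = norm (w - c)" using q2[OF w] by (metis norm_power)
      moreover have "9 * T \<le> norm (w - c)" using norm_triangle_ineq2[of w c] far \<Omega>(5) by linarith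
      ultimately have "(2 * norm p) ^ 2 \<le> norm (q w) ^ 2" using np bc T by (simp add: power_mult_distrib)
      then have "2 * norm p \<le> norm (q w)" by (rule power2_le_imp_le) simp
      then have "norm (q w + p) \<le> 3 * norm (q w - p)"
        using norm_triangle_ineq[of "q w" p] norm_triangle_ineq2[of "q w" p] by linarith
      then show ?thesis unfolding u_def norm_divide using nz[OF w] by (simp add: le_divide_eq)
    qed
  qed
qed

lemma bungee_set_image_iff: "f x \<in> bungee_set f \<longleftrightarrow> x \<in> bungee_set f"
proof -
  have sh: "(f ^^ n) (f x) = (f ^^ Suc n) x" for n by (simp add: funpow_swap1)
  have "f x \<in> escaping_set f \<longleftrightarrow> x \<in> escaping_set f"
    unfolding escaping_set_def mem_Collect_eq sh by (rule filterlim_sequentially_Suc)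
  moreover have "f x \<in> bounded_orbit_set f \<longleftrightarrow> x \<in> bounded_orbit_set f"
  proof
    assume "f x \<in> bounded_orbit_set f"
    then obtain K where K: "K > 0" "\<And>n. norm ((f ^^ Suc n) x) < K" unfolding bounded_orbit_set_def mem_Collect_eq sh by blast
    have "norm ((f ^^ n) x) < K + norm x" for n
    proof (cases n)
      case (Suc m)
      show ?thesis unfolding Suc using K(2)[of m] norm_ge_zero[of x] by linarith
    qed (simp add: K(1))
    then show "x \<in> bounded_orbit_set f"
      unfolding bounded_orbit_set_def using K(1) norm_ge_zero[of x] by (auto intro!: exI[of _ "K + norm x"] add_pos_nonneg)
  next
    assume "x \<in> bounded_orbit_set f"
    then show "f x \<in> bounded_orbit_set f" unfolding bounded_orbit_set_def mem_Collect_eq sh by blast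
  qed
  ultimately show ?thesis by (simp add: bungee_set_def)
qed

lemma bungee_set_funpow_iff: "(f ^^ n) x \<in> bungee_set f \<longleftrightarrow> x \<in> bungee_set f"
  by (induction n) (simp_all add: bungee_set_image_iff)

lemma not_escapingE:
  assumes "x \<notin> escaping_set f"
  obtains K where "infinite {n. norm ((f ^^ n) x) < K}"
proof -
  obtain K where "\<not> (\<forall>\<^sub>F n in sequentially. K \<le> norm ((f ^^ n) x))"
    using assms unfolding escaping_set_def mem_Collect_eq filterlim_at_infinity[OF order_refl] by blast
  then have "infinite {n. norm ((f ^^ n) x) < K}"
    unfolding eventually_sequentially infinite_nat_iff_unbounded_le by (auto simp: not_le)
  then show ?thesis by (rule that)
qed

lemma not_bounded_orbitE:
  assumes "x \<notin> bounded_orbit_set f"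
  obtains n where "K \<le> norm ((f ^^ n) x)"
proof -
  have "\<not> (\<forall>n. norm ((f ^^ n) x) < max K 1)"
  proof
    assume "\<forall>n. norm ((f ^^ n) x) < max K 1"
    then have "x \<in> bounded_orbit_set f"
      unfolding bounded_orbit_set_def by (auto intro!: exI[of _ "max K 1"])
    then show False using assms by blast
  qed
  then show ?thesis using that by (auto simp: not_less)
qed

text \<open>A subsequence bounded at \<open>x\<close> cannot diverge on \<open>V\<close>, so a
  further one converges at \<open>y\<close> and \<open>y\<close> does not escape. A subsequence
  unbounded at \<open>x\<close> cannot converge, so a further one diverges at \<open>y\<close> as
  well.\<close>

lemma bungee_set_normal_domain:
  assumes V: "normal_family_on (range (\<lambda>n. f ^^ n)) V" and x: "x \<in> V" "x \<in> bungee_set f" and y: "y \<in> V"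
  shows "y \<in> bungee_set f"
proof -
  have xI: "x \<notin> escaping_set f" and xB: "x \<notin> bounded_orbit_set f" using x by (auto simp: bungee_set_def)
  have c: "{x} \<subseteq> V \<and> compact {x}" "{y} \<subseteq> V \<and> compact {y}" using x y by auto
  have "y \<notin> escaping_set f"
  proof
    assume yI: "y \<in> escaping_set f"
    obtain K where "infinite {n. norm ((f ^^ n) x) < K}" using not_escapingE[OF xI] .
    from infinite_set_subsequence[OF this]
    obtain s where s: "strict_mono (s::nat\<Rightarrow>nat)" "\<And>n. norm ((f ^^ s n) x) < K" by blast
    obtain t where t: "strict_mono t" and
      alt: "(\<exists>h. \<forall>C. C \<subseteq> V \<and> compact C \<longrightarrow> uniform_limit C (\<lambda>j. f ^^ s (t j)) h sequentially)
           \<or> (\<forall>C. C \<subseteq> V \<and> compact C \<longrightarrow> (\<forall>B. \<forall>\<^sub>F j in sequentially. \<forall>z\<in>C. B \<le> norm ((f ^^ s (t j)) z)))"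
      using V[unfolded normal_family_on_def, rule_format, of "\<lambda>j. f ^^ s j"] by blast
    have st: "strict_mono (\<lambda>j. s (t j))" using s(1) t by (simp add: strict_mono_def)
    from alt show False
    proof
      assume "\<exists>h. \<forall>C. C \<subseteq> V \<and> compact C \<longrightarrow> uniform_limit C (\<lambda>j. f ^^ s (t j)) h sequentially"
      then obtain h where "uniform_limit {y} (\<lambda>j. f ^^ s (t j)) h sequentially" using c(2) by blast
      then have "(\<lambda>j. (f ^^ s (t j)) y) \<longlonglongrightarrow> h y" by (rule tendsto_uniform_limitI) simp
      moreover have "filterlim (\<lambda>j. (f ^^ s (t j)) y) at_infinity sequentially"
        using filterlim_compose[OF yI[unfolded escaping_set_def mem_Collect_eq] filterlim_subseq[OF st]] .
      ultimately show False using not_tendsto_and_filterlim_at_infinity sequentially_bot by blast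
    next
      assume "\<forall>C. C \<subseteq> V \<and> compact C \<longrightarrow> (\<forall>B. \<forall>\<^sub>F j in sequentially. \<forall>z\<in>C. B \<le> norm ((f ^^ s (t j)) z))"
      then have "\<forall>\<^sub>F j in sequentially. \<forall>z\<in>{x}. K \<le> norm ((f ^^ s (t j)) z)" using c(1) by blast
      from eventually_happens'[OF sequentially_bot this] obtain j where "K \<le> norm ((f ^^ s (t j)) x)" by blast
      then show False using s(2)[of "t j"] by linarith
    qed
  qed
  moreover have "y \<notin> bounded_orbit_set f"
  proof
    assume "y \<in> bounded_orbit_set f"
    then obtain K where K: "\<And>n. norm ((f ^^ n) y) < K" unfolding bounded_orbit_set_def by blast
    have "\<forall>k::nat. \<exists>n. real k \<le> norm ((f ^^ n) x)" using not_bounded_orbitE[OF xB] by metis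
    \<comment> \<open>This \<open>s\<close> need not be increasing: the lower bound
      \<open>real k\<close> survives passing to the subsequence \<open>t\<close>.\<close>
    then obtain s where s: "\<And>k. real k \<le> norm ((f ^^ s k) x)" by metis
    obtain t where t: "strict_mono t" and
      alt: "(\<exists>h. \<forall>C. C \<subseteq> V \<and> compact C \<longrightarrow> uniform_limit C (\<lambda>j. f ^^ s (t j)) h sequentially)
           \<or> (\<forall>C. C \<subseteq> V \<and> compact C \<longrightarrow> (\<forall>B. \<forall>\<^sub>F j in sequentially. \<forall>z\<in>C. B \<le> norm ((f ^^ s (t j)) z)))"
      using V[unfolded normal_family_on_def, rule_format, of "\<lambda>j. f ^^ s j"] by blast
    from alt show False
    proof
      assume "\<exists>h. \<forall>C. C \<subseteq> V \<and> compact C \<longrightarrow> uniform_limit C (\<lambda>j. f ^^ s (t j)) h sequentially"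
      then obtain h where "uniform_limit {x} (\<lambda>j. f ^^ s (t j)) h sequentially" using c(1) by blast
      then have lim: "(\<lambda>j. (f ^^ s (t j)) x) \<longlonglongrightarrow> h x" by (rule tendsto_uniform_limitI) simp
      have "filterlim (\<lambda>j. norm ((f ^^ s (t j)) x)) at_top sequentially"
      proof (rule filterlim_at_top_mono[OF filterlim_real_sequentially])
        have "real j \<le> norm ((f ^^ s (t j)) x)" for j
          using s[of "t j"] seq_suble[OF t, of j] by (meson of_nat_mono order_trans)
        then show "\<forall>\<^sub>F j in sequentially. real j \<le> norm ((f ^^ s (t j)) x)" by simp
      qed
      then have "filterlim (\<lambda>j. (f ^^ s (t j)) x) at_infinity sequentially"
        by (rule filterlim_norm_at_top_imp_at_infinity)
      then show False using lim not_tendsto_and_filterlim_at_infinity sequentially_bot by blast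
    next
      assume "\<forall>C. C \<subseteq> V \<and> compact C \<longrightarrow> (\<forall>B. \<forall>\<^sub>F j in sequentially. \<forall>z\<in>C. B \<le> norm ((f ^^ s (t j)) z))"
      then have "\<forall>\<^sub>F j in sequentially. \<forall>z\<in>{y}. K \<le> norm ((f ^^ s (t j)) z)" using c(2) by blast
      from eventually_happens'[OF sequentially_bot this] obtain j where "K \<le> norm ((f ^^ s (t j)) y)" by blast
      then show False using K[of "s (t j)"] by linarith
    qed
  qed
  ultimately show ?thesis by (simp add: bungee_set_def)
qed

section \<open>Bounded wandering domains\<close>

text \<open>Each normal neighbourhood lies inside or outside the bungee set, so connectedness
  decides for all of \<open>G\<close>. A Fatou point on the frontier would have such a neighbourhood
  meeting \<open>G\<close>, and so be a bungee point.\<close>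

lemma fatou_domain_bungee:
  assumes G: "open G" "connected G" "G \<subseteq> fatou_set f" "G \<inter> bungee_set f \<noteq> {}" "frontier G \<inter> bungee_set f = {}"
  shows "G \<subseteq> bungee_set f" "frontier G \<subseteq> julia_set f"
proof -
  define A where "A = \<Union>{V. open V \<and> normal_family_on (range (\<lambda>n. f ^^ n)) V \<and> V \<subseteq> bungee_set f}"
  define B where "B = \<Union>{V. open V \<and> normal_family_on (range (\<lambda>n. f ^^ n)) V \<and> V \<inter> bungee_set f = {}}"
  have F: "\<exists>V. open V \<and> x \<in> V \<and> normal_family_on (range (\<lambda>n. f ^^ n)) V \<and> (V \<subseteq> bungee_set f \<or> V \<inter> bungee_set f = {})"
    if x: "x \<in> fatou_set f" for x
  proof -
    obtain V where V: "open V" "x \<in> V" "normal_family_on (range (\<lambda>n. f ^^ n)) V"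
      using x unfolding fatou_set_def by blast
    then show ?thesis using bungee_set_normal_domain[OF V(3)] by blast
  qed
  have cov: "G \<subseteq> A \<union> B"
  proof
    fix x assume "x \<in> G"
    then have "x \<in> fatou_set f" using G(3) by blast
    then show "x \<in> A \<union> B" using F[of x] unfolding A_def B_def by blast
  qed
  have "A \<subseteq> bungee_set f" "B \<inter> bungee_set f = {}" unfolding A_def B_def by blast+
  moreover have "A \<inter> G = {} \<or> B \<inter> G = {}"
  proof (rule connectedD[OF G(2)])
    show "open A" "open B" unfolding A_def B_def by auto
    show "A \<inter> B \<inter> G = {}" using calculation by blast
  qed (rule cov)
  ultimately show GB: "G \<subseteq> bungee_set f" using cov G(4) by blast
  show "frontier G \<subseteq> julia_set f"
  proof
    fix y assume y: "y \<in> frontier G"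
    show "y \<in> julia_set f"
    proof (rule ccontr)
      assume "y \<notin> julia_set f"
      then have "y \<in> fatou_set f" by (simp add: julia_set_def)
      then obtain V where V: "open V" "y \<in> V" "normal_family_on (range (\<lambda>n. f ^^ n)) V"
        unfolding fatou_set_def by blast
      have "y \<in> closure G" using y by (simp add: frontier_def)
      then have "V \<inter> G \<noteq> {}" using V open_Int_closure_eq_empty[OF V(1), of G] by blast
      then have "y \<in> bungee_set f" using bungee_set_normal_domain[OF V(3)] V(2) GB by blast
      then show False using y G(5) by blast
    qed
  qed
qed

context log_tract begin

context
  fixes G :: "complex set"
  assumes G: "open G" "connected G" "bounded G" "G \<noteq> {}" "G \<subseteq> bungee_set f"
    and frG: "frontier G \<inter> bungee_set f = {}"
begin

text \<open>Membership in the bungee set is unchanged by \<open>f\<close> in both directions, so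
  each iterate inherits the assumptions on \<open>G\<close>;
  \<open>julia_frontier_meets_bungee\<close> then keeps it off the Julia set.\<close>

lemma wandering_images:
  shows "open ((f ^^ n) ` G)" "connected ((f ^^ n) ` G)" "bounded ((f ^^ n) ` G)"
    "(f ^^ n) ` G \<subseteq> bungee_set f" "frontier ((f ^^ n) ` G) \<inter> bungee_set f = {}"
    "(f ^^ n) ` G \<inter> julia_set f = {}"
proof -
  show op: "open ((f ^^ n) ` G)" by (rule funpow_open_image[OF open_image G(1)])
  show "connected ((f ^^ n) ` G)" by (intro connected_continuous_image funpow_continuous[OF entire] G(2))
  have "bounded ((f ^^ n) ` closure G)"
    using G(3) by (intro compact_imp_bounded compact_continuous_image funpow_continuous[OF entire]) (simp add: compact_closure)
  then show bd: "bounded ((f ^^ n) ` G)" by (rule bounded_subset) (intro image_mono closure_subset)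
  show "(f ^^ n) ` G \<subseteq> bungee_set f" using G(5) bungee_set_funpow_iff by blast
  have "frontier ((f ^^ n) ` G) \<subseteq> (f ^^ n) ` frontier G"
    by (rule frontier_image_subset[OF funpow_continuous[OF entire] G(3) op])
  then show fr: "frontier ((f ^^ n) ` G) \<inter> bungee_set f = {}" using frG bungee_set_funpow_iff by blast
  show "(f ^^ n) ` G \<inter> julia_set f = {}"
    using julia_frontier_meets_bungee[OF op bd] fr by blast
qed

text \<open>Two images that meet must coincide, since otherwise one, made of bungee points, would
  cross the frontier of the other, which has none. Coincidence at different times would confine
  every orbit to finitely many bounded images.\<close>

lemma wandering_images_disjoint:
  assumes "m < n"
  shows "(f ^^ m) ` G \<inter> (f ^^ n) ` G = {}"
proof (rule ccontr)
  assume ne: "(f ^^ m) ` G \<inter> (f ^^ n) ` G \<noteq> {}"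
  have sub: "(f ^^ i) ` G \<subseteq> (f ^^ j) ` G" if "(f ^^ i) ` G \<inter> (f ^^ j) ` G \<noteq> {}" for i j
  proof (rule ccontr)
    assume "\<not> (f ^^ i) ` G \<subseteq> (f ^^ j) ` G"
    then have "(f ^^ i) ` G - (f ^^ j) ` G \<noteq> {}" by blast
    then have "(f ^^ i) ` G \<inter> frontier ((f ^^ j) ` G) \<noteq> {}"
      using connected_Int_frontier[OF wandering_images(2) that] by blast
    then show False using wandering_images(4)[of i] wandering_images(5)[of j] by blast
  qed
  have eq: "(f ^^ m) ` G = (f ^^ n) ` G" using sub[of m n] sub[of n m] ne by blast
  have red: "(f ^^ k) ` G \<subseteq> (\<Union>i<n. (f ^^ i) ` G)" for k
  proof (induction k rule: less_induct)
    case (less k)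
    show ?case
    proof (cases "k < n")
      case False
      have "(f ^^ k) ` G = (f ^^ (k - n)) ` (f ^^ n) ` G"
        using False by (simp add: image_comp flip: funpow_add)
      also have "\<dots> = (f ^^ (k - n + m)) ` G" unfolding eq[symmetric] by (simp add: image_comp flip: funpow_add)
      also have "\<dots> \<subseteq> (\<Union>i<n. (f ^^ i) ` G)" using False assms by (intro less) simp
      finally show ?thesis .
    qed blast
  qed
  have "bounded (\<Union>i<n. (f ^^ i) ` G)" using wandering_images(3) by (intro bounded_UN) auto
  then obtain K where K: "K > 0" "\<And>x. x \<in> (\<Union>i<n. (f ^^ i) ` G) \<Longrightarrow> norm x < K"
    unfolding bounded_pos_less by blast
  obtain z where z: "z \<in> G" using G(4) by blast
  have "norm ((f ^^ k) z) < K" for k using K(2) red[of k] z by blast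
  then have "z \<in> bounded_orbit_set f" using K(1) by (auto simp: bounded_orbit_set_def)
  then show False using z G(5) by (auto simp: bungee_set_def)
qed

text \<open>\<open>sqrt_barrier\<close> is applied with \<open>b = z0\<close>, a value that later
  images of \<open>G\<close> avoid. Dividing by 9 gives the bound 1 and turns the constants 1/3 and
  27 into 1/27 and 3.\<close>

lemma far_orbit_barrier:
  assumes z0: "z0 \<in> G" and n: "n > 0" and T: "norm \<alpha> < T" "4 * norm z0 \<le> T" "K \<le> T" and far: "10 * T \<le> norm ((f ^^ n) z0)"
  obtains g where "g holomorphic_on G" "\<And>z. z \<in> G \<Longrightarrow> g z \<noteq> 0 \<and> norm (g z) \<le> 1" "1 / 27 \<le> norm (g z0)"
    "\<And>z. z \<in> G \<Longrightarrow> norm ((f ^^ n) z) < K \<Longrightarrow> norm (g z) \<le> 3 * (K + norm z0) / T"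
proof (cases "(f ^^ n) ` G \<inter> ball 0 T = {}")
  case True
  show ?thesis
    \<comment> \<open>If the image misses \<open>ball 0 T\<close>, the last condition is vacuous
      because \<open>K \<le> T\<close>.\<close>
    by (rule that[of "\<lambda>_. 1"]) (use True T(3) in \<open>force simp: disjoint_iff\<close>)+
next
  case False
  have Tpos: "T > 0" using T(1) norm_ge_zero[of \<alpha>] by linarith
  obtain S0 where S0: "\<And>x. x \<in> (f ^^ n) ` G \<Longrightarrow> norm x < S0" using wandering_images(3)[of n] unfolding bounded_pos_less by blast
  define S where "S = max S0 (T + 1)"
  have S: "T < S" "\<And>x. x \<in> (f ^^ n) ` G \<Longrightarrow> norm x < S" using S0 unfolding S_def by (auto simp: less_max_iff_disj)
  obtain L c where L: "compact L" "connected L" "sphere 0 S \<subseteq> L" "c \<in> L" "norm c = T"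
    "L \<subseteq> (julia_set f \<inter> cball 0 S - ball 0 T) \<union> sphere 0 S"
    using julia_continuum_to_sphere[OF T(1) S(1)] .
  \<comment> \<open>Attaching the exterior of a disc containing the image makes the continuum
    unbounded and keeps it connected, so complementary components of \<open>Y\<close> are simply
    connected. The point \<open>c\<close> on the circle of radius \<open>T\<close> supplies the
    branch point.\<close>
  define Y where "Y = L \<union> - ball 0 S"
  have closedY: "closed Y" unfolding Y_def using L(1) compact_imp_closed by auto
  have connY: "connected Y"
  proof -
    have "connected (- ball (0::complex) S)"
      by (rule connected_complement_bounded_convex) auto
    moreover have "complex_of_real S \<in> L \<inter> - ball 0 S" using L(3) S(1) Tpos by auto
    ultimately show ?thesis unfolding Y_def using L(2) by (intro connected_Un) auto
  qed
  have YT: "Y \<inter> ball 0 T = {}" using L(6) S(1) unfolding Y_def by (auto simp: subset_iff)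
  have YG: "Y \<inter> (f ^^ n) ` G = {}"
    using L(6) wandering_images(6)[of n] S(2) unfolding Y_def by (fastforce simp: disjoint_iff)
  define \<Omega> where "\<Omega> = connected_component_set (- Y) 0"
  have oY: "0 \<in> - Y" using YT Tpos centre_in_ball[of 0 T] by blast
  have comp: "\<Omega> \<in> components (- Y)" unfolding \<Omega>_def using oY by (rule componentsI)
  have op\<Omega>: "open \<Omega>" using closedY comp open_components open_Compl by blast
  have ball\<Omega>: "ball 0 T \<subseteq> \<Omega>" unfolding \<Omega>_def
    by (rule connected_component_maximal) (use Tpos YT in auto)
  have G\<Omega>: "(f ^^ n) ` G \<subseteq> \<Omega>"
    using components_maximal[OF comp wandering_images(2)[of n]] YG False ball\<Omega> by blast
  have sub\<Omega>: "\<Omega> \<subseteq> - Y" using in_components_subset[OF comp] .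
  have sc: "simply_connected \<Omega>"
    unfolding simply_connected_eq_unbounded_complement_components[OF op\<Omega>]
  proof (intro conjI ballI notI)
    show "connected \<Omega>" using in_components_connected[OF comp] .
    fix C assume C: "C \<in> components (- \<Omega>)" "bounded C"
    have "connected (- \<Omega>)" using component_complement_connected[OF connY comp] .
    then have "C = - \<Omega>" using C(1) connected_eq_components_subset_sing[of "- \<Omega>"] by blast
    then have "bounded (- ball (0::complex) S)"
      using C(2) sub\<Omega> unfolding Y_def by (elim bounded_subset) blast
    then show False using bounded_ball[of "0::complex" S] by (metis bounded_Un Compl_partition not_bounded_UNIV)
  qed
  have c: "c \<notin> \<Omega>" using sub\<Omega> L(4) unfolding Y_def by blast
  have z4: "norm z0 \<le> T / 4" using T(2) by simp
  obtain u where u: "u holomorphic_on \<Omega>" "\<And>w. w \<in> \<Omega> \<Longrightarrow> w \<noteq> z0 \<Longrightarrow> u w \<noteq> 0" "\<And>w. w \<in> \<Omega> \<Longrightarrow> norm (u w) \<le> 9"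
    "\<And>w. w \<in> \<Omega> \<Longrightarrow> norm (u w) \<le> 27 * norm (w - z0) / T"
    "\<And>w. w \<in> \<Omega> \<Longrightarrow> 10 * T \<le> norm w \<Longrightarrow> 1/3 \<le> norm (u w)"
    using sqrt_barrier[OF op\<Omega> sc ball\<Omega> c L(5) Tpos z4] by metis
  have avoid: "(f ^^ n) z \<noteq> z0" if "z \<in> G" for z
    using wandering_images_disjoint[OF n] that z0 by auto
  define g where "g = (\<lambda>z. u ((f ^^ n) z) / 9)"
  have in\<Omega>: "(f ^^ n) z \<in> \<Omega>" if "z \<in> G" for z using G\<Omega> that by blast
  show ?thesis
  proof
    have "(u \<circ> (f ^^ n)) holomorphic_on G"
      by (rule holomorphic_on_compose_gen[OF funpow_holomorphic[OF entire] u(1) G\<Omega>])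
    then show "g holomorphic_on G" unfolding g_def o_def by (intro holomorphic_intros) auto
    show "g z \<noteq> 0 \<and> norm (g z) \<le> 1" if "z \<in> G" for z
      using u(2,3)[OF in\<Omega>[OF that]] avoid[OF that] by (simp add: g_def norm_divide)
    show "1 / 27 \<le> norm (g z0)"
      using u(5)[OF in\<Omega>[OF z0] far] by (simp add: g_def norm_divide)
    show "norm (g z) \<le> 3 * (K + norm z0) / T" if z: "z \<in> G" "norm ((f ^^ n) z) < K" for z
    proof -
      have "norm (g z) \<le> 3 * norm ((f ^^ n) z - z0) / T"
        using u(4)[OF in\<Omega>[OF z(1)]] by (simp add: g_def norm_divide)
      also have "\<dots> \<le> 3 * (K + norm z0) / T"
        using norm_triangle_ineq4[of "(f ^^ n) z" z0] z(2) Tpos by (intro divide_right_mono) auto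
      finally show ?thesis .
    qed
  qed
qed

end

end

section \<open>The harmonic measure argument on the frontier of a wandering domain\<close>

context log_tract begin

lemma wandering_frontier_impossible:
  assumes G: "open G" "connected G" "bounded G" "G \<noteq> {}" "G \<subseteq> bungee_set f"
    and frG: "frontier G \<inter> bungee_set f = {}" and frJ: "frontier G \<subseteq> julia_set f"
  shows False
proof -
  note images = wandering_images[OF G frG] and disjoint = wandering_images_disjoint[OF G frG]
  have "G \<subseteq> fatou_set f" using images(6)[of 0] by (auto simp: julia_set_def)
  then have sc: "simply_connected G" by (rule bounded_fatou_domain_simply_connected[OF G(1-3) _ frJ])
  obtain z0 where z0: "z0 \<in> G" using G(4) by blast
  obtain X where Xm: "X \<in> borel_measurable unit_interval_measure"
    and Xfr: "AE t in unit_interval_measure. X t \<in> frontier G"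
    and Xb: "\<And>g Q \<tau>. g holomorphic_on G \<Longrightarrow> (\<And>z. z \<in> G \<Longrightarrow> g z \<noteq> 0 \<and> norm (g z) \<le> 1) \<Longrightarrow> open Q \<Longrightarrow>
       0 < \<tau> \<Longrightarrow> \<tau> < 1 \<Longrightarrow> (\<And>z. z \<in> G \<inter> Q \<Longrightarrow> norm (g z) \<le> \<tau>) \<Longrightarrow>
       measure unit_interval_measure {t \<in> {0..1}. X t \<in> Q} \<le> ln (norm (g z0)) / ln \<tau>"
    by (rule harmonic_measure_bound[OF G(1) sc G(3) z0]) blast
  interpret finite_measure unit_interval_measure by (rule unit_interval_measure_finite)
  have setQ: "{t \<in> {0..1}. X t \<in> Q} \<in> sets unit_interval_measure" if "open Q" for Q
    using measurable_sets[OF Xm, of Q] that by (simp add: vimage_def Int_def conj_commute)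
  obtain \<delta> where \<delta>: "\<delta> > 0" "ball z0 \<delta> \<subseteq> G" using G(1) z0 open_contains_ball by blast
  have away: "\<delta> \<le> norm ((f ^^ n) z - z0)" if "n > 0" "z \<in> G" for n z
  proof (rule ccontr)
    assume "\<not> ?thesis"
    then have "(f ^^ n) z \<in> G" using \<delta>(2) by (auto simp: dist_norm norm_minus_commute subset_iff)
    then show False using disjoint[OF that(1)] that(2) by auto
  qed
  have zI: "z0 \<notin> escaping_set f" and zB: "z0 \<notin> bounded_orbit_set f" using z0 G(5) by (auto simp: bungee_set_def)
  obtain K0 where "infinite {n. norm ((f ^^ n) z0) < K0}" using not_escapingE[OF zI] .
  then have "infinite ({n. norm ((f ^^ n) z0) < K0} - {0})" by (rule infinite_remove)
  moreover define N1 where "N1 = {n. 0 < n \<and> norm ((f ^^ n) z0) < K0}"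
  have "{n. norm ((f ^^ n) z0) < K0} - {0} = N1" by (auto simp: N1_def)
  ultimately have infN1: "infinite N1" by simp
  \<comment> \<open>Bounds \<open>- ln (norm (g z0))\<close> uniformly over \<open>N1\<close> for
    the functions \<open>g\<close> below; time 0 was removed because \<open>away\<close> requires
    \<open>n > 0\<close>.\<close>
  define c0 where "c0 = ln ((K0 + norm z0) / \<delta>)"
  have near: "norm ((f ^^ n) z0 - z0) \<le> K0 + norm z0" if "n \<in> N1" for n
    using norm_triangle_ineq4[of "(f ^^ n) z0" z0] that by (simp add: N1_def)
  have c0: "c0 \<ge> 0"
  proof -
    obtain n where n: "n \<in> N1" using infN1 infinite_imp_nonempty by blast
    have "\<delta> \<le> K0 + norm z0" using near[OF n] away[of n z0] n z0 by (simp add: N1_def)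
    then show ?thesis unfolding c0_def using \<delta>(1) by simp
  qed
  \<comment> \<open>Chosen so that \<open>\<delta> / R\<close> is
    \<open>exp (- (4 * c0 + 1))\<close> and the measure bound becomes
    \<open>c0 / (4 * c0 + 1)\<close>, at most 1/4. The summand 1 keeps the denominator positive when
    \<open>c0\<close> is 0.\<close>
  define R where "R = \<delta> * exp (4 * c0 + 1)"
  have Rpos: "R > 0" using \<delta>(1) by (simp add: R_def)
  define QB where "QB = (\<lambda>n. {z. R < norm ((f ^^ n) z - z0)})"
  have opQB: "open (QB n)" for n
    unfolding QB_def by (intro open_Collect_less continuous_intros funpow_continuous[OF entire])
  have mB: "measure unit_interval_measure {t \<in> {0..1}. X t \<in> QB n} \<le> 1 / 4" if n: "n \<in> N1" for n
  proof -
    have n0: "n > 0" using n by (simp add: N1_def)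
    define g where "g = (\<lambda>z. of_real \<delta> / ((f ^^ n) z - z0))"
    have nz: "(f ^^ n) z - z0 \<noteq> 0" if "z \<in> G" for z using away[OF n0 that] \<delta>(1) by auto
    define \<tau> where "\<tau> = exp (- (4 * c0 + 1))"
    have \<tau>R: "\<tau> = \<delta> / R" unfolding \<tau>_def R_def exp_minus using \<delta>(1) by (simp add: inverse_eq_divide)
    have "measure unit_interval_measure {t \<in> {0..1}. X t \<in> QB n} \<le> ln (norm (g z0)) / ln \<tau>"
    proof (rule Xb)
      show "g holomorphic_on G" unfolding g_def using nz by (intro holomorphic_intros funpow_holomorphic[OF entire])
      show "g z \<noteq> 0 \<and> norm (g z) \<le> 1" if "z \<in> G" for z
        using nz[OF that] away[OF n0 that] \<delta>(1) by (simp add: g_def norm_divide)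
      show "norm (g z) \<le> \<tau>" if z: "z \<in> G \<inter> QB n" for z
      proof -
        have "norm (g z) = \<delta> / norm ((f ^^ n) z - z0)" using \<delta>(1) by (simp add: g_def norm_divide)
        also have "\<dots> \<le> \<delta> / R" using z \<delta>(1) Rpos by (intro divide_left_mono mult_pos_pos) (auto simp: QB_def)
        finally show ?thesis by (simp add: \<tau>R)
      qed
      show "0 < \<tau>" "\<tau> < 1" using c0 by (auto simp: \<tau>_def)
    qed (rule opQB)
    also have "\<dots> = (- ln (norm (g z0))) / (4 * c0 + 1)" unfolding \<tau>_def ln_exp by (metis divide_minus_right minus_divide_left)
    also have "\<dots> \<le> c0 / (4 * c0 + 1)"
    proof (rule divide_right_mono)
      have pos: "0 < norm ((f ^^ n) z0 - z0)" using nz[OF z0] by simp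
      have "- ln (norm (g z0)) = ln (norm ((f ^^ n) z0 - z0) / \<delta>)"
        using pos \<delta>(1) by (simp add: g_def norm_divide ln_div)
      also have "\<dots> \<le> c0" unfolding c0_def
        using near[OF n] pos \<delta>(1) by (intro ln_mono divide_right_mono divide_pos_pos) linarith+
      finally show "- ln (norm (g z0)) \<le> c0" .
    qed (use c0 in simp)
    also have "\<dots> \<le> 1 / 4" using c0 by (simp add: field_simps)
    finally show ?thesis .
  qed
  have "\<exists>m. measure unit_interval_measure {t \<in> {0..1}. norm ((f ^^ m) (X t)) < real k + 1} \<le> (1/2) ^ (k + 3)" for k
  proof -
    define \<epsilon> where "\<epsilon> = (1/2::real) ^ (k + 3)"
    have \<epsilon>: "\<epsilon> > 0" by (simp add: \<epsilon>_def)
    define K where "K = real k + 1"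
    \<comment> \<open>With \<open>norm (g z0)\<close> at least 1/27, this makes the quotient of
      logarithms at most \<open>\<epsilon>\<close>.\<close>
    define \<tau> where "\<tau> = exp (- (ln 27 / \<epsilon>))"
    have l27: "ln (27::real) > 0" by simp
    have \<tau>: "0 < \<tau>" "\<tau> < 1" using \<epsilon> l27 by (auto simp: \<tau>_def)
    define s where "s = 3 * (K + norm z0) / \<tau>"
    define T where "T = s + norm \<alpha> + 4 * norm z0 + K + 1"
    have s0: "s \<ge> 0" using \<tau> by (simp add: s_def K_def)
    have K0: "K \<ge> 0" by (simp add: K_def)
    have T: "norm \<alpha> < T" "4 * norm z0 \<le> T" "K \<le> T" "s \<le> T" "T > 0"
      unfolding T_def using s0 K0 norm_ge_zero[of \<alpha>] norm_ge_zero[of z0] by linarith+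
    have \<tau>T: "3 * (K + norm z0) / T \<le> \<tau>"
      using T(4,5) \<tau>(1) by (simp add: s_def field_simps)
    \<comment> \<open>The extra \<open>norm z0\<close> excludes \<open>m = 0\<close>.\<close>
    obtain m where m: "10 * T + norm z0 \<le> norm ((f ^^ m) z0)" using not_bounded_orbitE[OF zB] .
    have m0: "m > 0" using m T(5) by (cases m) auto
    have far: "10 * T \<le> norm ((f ^^ m) z0)" using m norm_ge_zero[of z0] by linarith
    obtain g where g: "g holomorphic_on G" "\<And>z. z \<in> G \<Longrightarrow> g z \<noteq> 0 \<and> norm (g z) \<le> 1" "1 / 27 \<le> norm (g z0)"
      "\<And>z. z \<in> G \<Longrightarrow> norm ((f ^^ m) z) < K \<Longrightarrow> norm (g z) \<le> 3 * (K + norm z0) / T"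
      by (rule far_orbit_barrier[OF G frG z0 m0 T(1-3) far]) blast
    have "measure unit_interval_measure {t \<in> {0..1}. X t \<in> {z. norm ((f ^^ m) z) < K}} \<le> ln (norm (g z0)) / ln \<tau>"
    proof (rule Xb[OF g(1,2)])
      show "open {z. norm ((f ^^ m) z) < K}"
        by (intro open_Collect_less continuous_intros funpow_continuous[OF entire])
      show "norm (g z) \<le> \<tau>" if "z \<in> G \<inter> {z. norm ((f ^^ m) z) < K}" for z
        using g(4)[of z] that \<tau>T by auto
    qed (use \<tau> in auto)
    also have "\<dots> = \<epsilon> * (- ln (norm (g z0))) / ln 27" by (simp add: \<tau>_def)
    also have "\<dots> \<le> \<epsilon> * ln 27 / ln 27"
    proof (intro divide_right_mono mult_left_mono)
      have "ln (1 / 27) \<le> ln (norm (g z0))" using g(3) by (intro ln_mono) auto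
      then show "- ln (norm (g z0)) \<le> ln 27" by (simp add: ln_div)
    qed (use \<epsilon> l27 in auto)
    also have "\<dots> = \<epsilon>" by simp
    finally show ?thesis unfolding K_def \<epsilon>_def by auto
  qed
  then obtain m where mD: "\<And>k. measure unit_interval_measure {t \<in> {0..1}. norm ((f ^^ m k) (X t)) < real k + 1} \<le> (1/2) ^ (k + 3)"
    by metis
  define D where "D = (\<lambda>k. {t \<in> {0..1}. norm ((f ^^ m k) (X t)) < real k + 1})"
  have setD: "D k \<in> sets unit_interval_measure" for k
  proof -
    have "open {z. norm ((f ^^ m k) z) < real k + 1}"
      by (intro open_Collect_less continuous_intros funpow_continuous[OF entire])
    from setQ[OF this] show ?thesis by (simp add: D_def)
  qed
  have geo: "(\<lambda>k. (1/2::real) ^ (k + 3)) sums (1 / 4)"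
    using sums_mult[OF geometric_sums[of "1/2::real"], of "1/8"] by (simp add: power_add power3_eq_cube)
  have sD: "summable (\<lambda>k. measure unit_interval_measure (D k))"
    by (rule summable_comparison_test'[OF sums_summable[OF geo], of 0]) (use mD in \<open>simp add: D_def\<close>)
  have "measure unit_interval_measure (\<Union>k. D k) \<le> (\<Sum>k. measure unit_interval_measure (D k))"
    by (rule finite_measure_subadditive_countably) (use setD sD in auto)
  also have "\<dots> \<le> (\<Sum>k. (1/2::real) ^ (k + 3))"
    by (rule suminf_le) (use mD sD sums_summable[OF geo] in \<open>auto simp: D_def\<close>)
  also have "\<dots> = 1 / 4" using geo by (simp add: sums_iff)
  finally have UD: "measure unit_interval_measure (\<Union>k. D k) \<le> 1 / 4" .
  \<comment> \<open>Escape of \<open>X t\<close> would put \<open>t\<close> in some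
    \<open>A N\<close>. Each \<open>A N\<close> lies in the event for any one
    \<open>n \<in> N1\<close> beyond \<open>N\<close>, so its measure needs no estimate uniform in
    time.\<close>
  define A where "A = (\<lambda>N. {t \<in> {0..1}. \<forall>n\<in>N1. N \<le> n \<longrightarrow> X t \<in> QB n})"
  have ex: "\<exists>n\<in>N1. N \<le> n" for N using infN1 unfolding infinite_nat_iff_unbounded_le by blast
  have setA: "A N \<in> sets unit_interval_measure" for N
  proof -
    have "A N = (\<Inter>n\<in>N1 \<inter> {N..}. {t \<in> {0..1}. X t \<in> QB n})" unfolding A_def using ex[of N] by auto
    moreover have "(\<Inter>n\<in>N1 \<inter> {N..}. {t \<in> {0..1}. X t \<in> QB n}) \<in> sets unit_interval_measure"
      using setQ[OF opQB] ex[of N] by (intro sets.countable_INT') auto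
    ultimately show ?thesis by simp
  qed
  have mA: "measure unit_interval_measure (A N) \<le> 1 / 4" for N
  proof -
    obtain n where n: "n \<in> N1" "N \<le> n" using ex by blast
    have "measure unit_interval_measure (A N) \<le> measure unit_interval_measure {t \<in> {0..1}. X t \<in> QB n}"
      by (rule finite_measure_mono[OF _ setQ[OF opQB]]) (use n in \<open>auto simp: A_def\<close>)
    then show ?thesis using mB[OF n(1)] by linarith
  qed
  have "(\<lambda>N. measure unit_interval_measure (A N)) \<longlonglongrightarrow> measure unit_interval_measure (\<Union>N. A N)"
    by (rule finite_Lim_measure_incseq) (use setA in \<open>auto simp: incseq_def A_def\<close>)
  then have UA: "measure unit_interval_measure (\<Union>N. A N) \<le> 1 / 4"
    by (rule LIMSEQ_le_const2) (use mA in auto)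
  have "\<exists>t\<in>{0..1}. t \<notin> (\<Union>k. D k) \<union> (\<Union>N. A N) \<and> X t \<in> frontier G"
  proof (rule ccontr)
    assume no: "\<not> ?thesis"
    have "measure unit_interval_measure {0..1} \<le> measure unit_interval_measure ((\<Union>k. D k) \<union> (\<Union>N. A N))"
    proof (rule finite_measure_mono_AE)
      show "AE t in unit_interval_measure. t \<in> {0..1} \<longrightarrow> t \<in> (\<Union>k. D k) \<union> (\<Union>N. A N)"
        using Xfr
      proof eventually_elim
        case (elim t)
        then show ?case using no by blast
      qed
    qed (use setA setD in auto)
    also have "\<dots> \<le> measure unit_interval_measure (\<Union>k. D k) + measure unit_interval_measure (\<Union>N. A N)"
      by (rule measure_Un_le) (use setA setD in auto)
    also have "\<dots> \<le> 1 / 2" using UD UA by linarith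
    also have "measure unit_interval_measure {0..1} = 1" by (simp add: measure_restrict_space)
    finally show False by simp
  qed
  then obtain t where t: "t \<in> {0..1}" "\<And>k. t \<notin> D k" "\<And>N. t \<notin> A N" "X t \<in> frontier G" by blast
  have "X t \<notin> bounded_orbit_set f"
  proof
    assume "X t \<in> bounded_orbit_set f"
    then obtain K where K: "\<And>n. norm ((f ^^ n) (X t)) < K" unfolding bounded_orbit_set_def by blast
    obtain k where "K \<le> real k" using real_arch_simple by blast
    then have "t \<in> D k" using K[of "m k"] t(1) by (simp add: D_def)
    then show False using t(2) by blast
  qed
  moreover have "X t \<notin> escaping_set f"
  proof
    assume "X t \<in> escaping_set f"
    then have "\<forall>\<^sub>F n in sequentially. R + norm z0 + 1 \<le> norm ((f ^^ n) (X t))"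
      unfolding escaping_set_def mem_Collect_eq filterlim_at_infinity[OF order_refl]
      using Rpos norm_ge_zero[of z0] by (auto simp del: norm_ge_zero)
    then obtain N where N: "\<And>n. n \<ge> N \<Longrightarrow> R + norm z0 + 1 \<le> norm ((f ^^ n) (X t))"
      unfolding eventually_sequentially by blast
    have "X t \<in> QB n" if "n \<ge> N" for n
      using N[OF that] norm_triangle_ineq2[of "(f ^^ n) (X t)" z0] by (simp add: QB_def)
    then have "t \<in> A N" using t(1) by (simp add: A_def)
    then show False using t(3) by blast
  qed
  ultimately show False using t(4) frG by (auto simp: bungee_set_def)
qed

lemma frontier_meets_bungee:
  assumes G: "open G" "bounded G" "G \<inter> bungee_set f \<noteq> {}"
  shows "frontier G \<inter> bungee_set f \<noteq> {}"
proof
  assume fr: "frontier G \<inter> bungee_set f = {}"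
  then have GJ: "G \<inter> julia_set f = {}" using julia_frontier_meets_bungee[OF G(1,2)] by blast
  obtain z where z: "z \<in> G" "z \<in> bungee_set f" using G(3) by blast
  \<comment> \<open>Passing to a component gives a connected domain, and its frontier stays inside
    \<open>frontier G\<close>.\<close>
  define V where "V = connected_component_set G z"
  have V: "open V" "connected V" "V \<subseteq> G" "z \<in> V"
    unfolding V_def using G(1) z(1) by (auto simp: open_connected_component connected_component_subset)
  have bV: "bounded V" using V(3) G(2) bounded_subset by blast
  have frV: "frontier V \<inter> bungee_set f = {}"
    using frontier_of_connected_component_subset[of G z] fr unfolding V_def by blast
  have VF: "V \<subseteq> fatou_set f" using V(3) GJ by (auto simp: julia_set_def)
  have ne: "V \<inter> bungee_set f \<noteq> {}" using V(4) z(2) by blast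
  note fb = fatou_domain_bungee[OF V(1,2) VF ne frV]
  show False using wandering_frontier_impossible[OF V(1,2) bV _ fb(1) frV fb(2)] V(4) by blast
qed

end

section \<open>Connectedness on the Riemann sphere\<close>

lemma sphere_of_near_infinity:
  assumes "open A" "sphere_infinity \<in> A"
  obtains R where "R > 0" "\<And>z. R < norm z \<Longrightarrow> sphere_of z \<in> A"
proof -
  obtain e where e: "e > 0" "ball sphere_infinity e \<subseteq> A" using assms open_contains_ball by blast
  \<comment> \<open>The distance to the pole is at most \<open>2 * (x + 1) / (1 + x\<^sup>2)\<close>
    with \<open>x = norm z\<close>, which is below \<open>4 / x\<close> for
    \<open>x > 1\<close>.\<close>
  define R where "R = max 1 (4 / e)"
  have "sphere_of z \<in> A" if z: "R < norm z" for z
  proof -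
    have z1: "norm z > 1" "4 / e < norm z" using z by (auto simp: R_def)
    define x where "x = norm z"
    have x: "x > 1" "4 < e * x" using z1 e(1) by (auto simp: x_def field_simps)
    have sq: "1 + x\<^sup>2 > 0" using zero_le_power2[of x] by linarith
    have "dist (sphere_of z) sphere_infinity = norm (sphere_of z - sphere_infinity)" by (simp add: dist_norm)
    also have "\<dots> \<le> norm (of_real (2 / (1 + x\<^sup>2)) * z) + norm ((x\<^sup>2 - 1) / (x\<^sup>2 + 1) - 1)"
      unfolding sphere_of_def sphere_infinity_def x_def diff_Pair norm_Pair
      using sqrt_sum_squares_le_sum[of "norm (of_real (2 / (1 + (norm z)\<^sup>2)) * z)" "norm (((norm z)\<^sup>2 - 1) / ((norm z)\<^sup>2 + 1) - 1)"]
      by simp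
    also have "norm (of_real (2 / (1 + x\<^sup>2)) * z) = 2 / (1 + x\<^sup>2) * x"
      using sq unfolding norm_mult norm_of_real x_def by simp
    also have "norm ((x\<^sup>2 - 1) / (x\<^sup>2 + 1) - 1) = 2 / (1 + x\<^sup>2)"
    proof -
      have "(x\<^sup>2 - 1) / (x\<^sup>2 + 1) - 1 = - (2 / (1 + x\<^sup>2))" using sq by (simp add: field_simps)
      then show ?thesis using sq by simp
    qed
    also have "2 / (1 + x\<^sup>2) * x + 2 / (1 + x\<^sup>2) = 2 * (x + 1) / (1 + x\<^sup>2)"
      by (simp add: algebra_simps flip: add_divide_distrib)
    also have "\<dots> < e"
    proof -
      have "2 * (x + 1) < 4 * x" using x by simp
      also have "\<dots> < e * x * x" using x mult_strict_right_mono[OF x(2), of x] by simp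
      also have "\<dots> < e * (1 + x\<^sup>2)" using e(1) by (simp add: power2_eq_square algebra_simps)
      finally show ?thesis using sq by (simp add: divide_less_eq)
    qed
    finally show ?thesis using e(2) by (auto simp: dist_commute)
  qed
  moreover have "R > 0" by (simp add: R_def less_max_iff_disj)
  ultimately show ?thesis using that by blast
qed

lemma continuous_sphere_of: "continuous_on UNIV sphere_of"
proof -
  have "1 + (cmod z)\<^sup>2 \<noteq> 0" "(cmod z)\<^sup>2 + 1 \<noteq> 0" for z :: complex using zero_le_power2[of "cmod z"] by linarith+
  then show ?thesis unfolding sphere_of_def[abs_def] by (intro continuous_intros) auto
qed

text \<open>A separation of the sphere set splits \<open>S\<close> into a bounded part
  \<open>Q\<close> and a part belonging to infinity. The points strictly closer to \<open>Q\<close>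
  form an open set whose frontier consists of equidistant points, and these cannot lie in either
  part.\<close>

lemma connected_insert_sphere_infinity:
  assumes frontier: "\<And>G. open G \<Longrightarrow> bounded G \<Longrightarrow> G \<inter> S \<noteq> {} \<Longrightarrow> frontier G \<inter> S \<noteq> {}"
  shows "connected (insert sphere_infinity (sphere_of ` S))"
proof -
  let ?S = "insert sphere_infinity (sphere_of ` S)"
  have key: False if A: "open A" and B: "open B" and cov: "?S \<subseteq> A \<union> B" and disj: "A \<inter> B \<inter> ?S = {}"
    and ne: "B \<inter> ?S \<noteq> {}" and inf: "sphere_infinity \<in> A" for A B
  proof -
    obtain R where R: "R > 0" "\<And>z. R < norm z \<Longrightarrow> sphere_of z \<in> A" using sphere_of_near_infinity[OF A inf] by blast
    \<comment> \<open>Including a full exterior region bounds \<open>G\<close>. Starting it at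
      \<open>R + 1\<close>, while \<open>Q\<close> lies within radius \<open>R\<close>, keeps the
      two parts separated.\<close>
    define P where "P = (S \<inter> sphere_of -` A) \<union> {z. R + 1 \<le> norm z}"
    define Q where "Q = S \<inter> sphere_of -` B"
    have opA: "open (sphere_of -` A)" and opB: "open (sphere_of -` B)"
      using open_vimage continuous_sphere_of A B by blast+
    have SPQ: "S \<subseteq> P \<union> Q" using cov unfolding P_def Q_def by blast
    have Qne: "Q \<noteq> {}" using ne inf disj unfolding Q_def by blast
    have Pne: "P \<noteq> {}"
    proof -
      have "complex_of_real (R + 1) \<in> P" using R(1) by (simp add: P_def del: of_real_add)
      then show ?thesis by blast
    qed
    have QR: "norm z \<le> R" if "z \<in> Q" for z
      using R(2)[of z] that disj unfolding Q_def by (force simp: disjoint_iff not_le[symmetric])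
    have clQ: "z \<notin> closure Q" if z: "z \<in> P" for z
    proof
      assume zc: "z \<in> closure Q"
      have "closure Q \<subseteq> cball 0 R" by (rule closure_minimal) (use QR in auto)
      then have "norm z \<le> R" using zc by auto
      then have "z \<in> sphere_of -` A" using z by (auto simp: P_def)
      moreover have "sphere_of -` A \<inter> Q = {}" using disj unfolding Q_def by blast
      then have "sphere_of -` A \<inter> closure Q = {}" using open_Int_closure_eq_empty[OF opA] by blast
      ultimately show False using zc by blast
    qed
    have clP: "z \<notin> closure P" if z: "z \<in> Q" for z
    proof
      assume zc: "z \<in> closure P"
      have "(sphere_of -` B \<inter> ball 0 (R + 1)) \<inter> P = {}"
      proof -
        have "sphere_of -` B \<inter> (S \<inter> sphere_of -` A) = {}" using disj by blast
        then show ?thesis unfolding P_def by auto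
      qed
      then have "(sphere_of -` B \<inter> ball 0 (R + 1)) \<inter> closure P = {}"
        using open_Int_closure_eq_empty[OF open_Int[OF opB open_ball]] by blast
      moreover have "z \<in> sphere_of -` B \<inter> ball 0 (R + 1)" using QR[OF z] z by (auto simp: Q_def)
      ultimately show False using zc by blast
    qed
    define G where "G = {z. infdist z Q < infdist z P}"
    have opG: "open G" unfolding G_def by (intro open_Collect_less continuous_intros)
    have "G \<subseteq> ball 0 (R + 1)"
    proof
      fix z assume z: "z \<in> G"
      then have "infdist z P \<noteq> 0" using infdist_nonneg[of z Q] by (auto simp: G_def)
      then have "z \<notin> P" by auto
      then show "z \<in> ball 0 (R + 1)" by (auto simp: P_def)
    qed
    then have bG: "bounded G" using bounded_ball bounded_subset by blast
    have "Q \<subseteq> G"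
    proof
      fix z assume z: "z \<in> Q"
      then have "infdist z P \<noteq> 0" using clP in_closure_iff_infdist_zero[OF Pne] by blast
      then show "z \<in> G" using z infdist_nonneg[of z P] by (simp add: G_def)
    qed
    then have "G \<inter> S \<noteq> {}" using Qne unfolding Q_def by blast
    then obtain z where z: "z \<in> frontier G" "z \<in> S" using frontier[OF opG bG] by blast
    have "closed {z. infdist z Q \<le> infdist z P}" by (intro closed_Collect_le continuous_intros)
    then have "closure G \<subseteq> {z. infdist z Q \<le> infdist z P}" by (rule closure_minimal[rotated]) (auto simp: G_def)
    then have "infdist z Q \<le> infdist z P" using z(1) by (auto simp: frontier_def)
    moreover have "\<not> infdist z Q < infdist z P" using z(1) opG by (auto simp: frontier_def interior_open G_def)
    ultimately have eq: "infdist z Q = infdist z P" by linarith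
    from SPQ z(2) consider "z \<in> P" | "z \<in> Q" by blast
    then show False
    proof cases
      case 1
      then show False using eq clQ[OF 1] in_closure_iff_infdist_zero[OF Qne] by simp
    next
      case 2
      then show False using eq clP[OF 2] in_closure_iff_infdist_zero[OF Pne] by simp
    qed
  qed
  show ?thesis
  proof (rule ccontr)
    assume "\<not> connected ?S"
    then obtain A B where AB: "open A" "open B" "?S \<subseteq> A \<union> B" "A \<inter> B \<inter> ?S = {}" "A \<inter> ?S \<noteq> {}" "B \<inter> ?S \<noteq> {}"
      unfolding connected_def by blast
    then have "sphere_infinity \<in> A \<or> sphere_infinity \<in> B" by blast
    then show False
    proof
      assume "sphere_infinity \<in> A"
      then show False by (rule key[OF AB(1-4,6)])
    next
      assume "sphere_infinity \<in> B"
      moreover have "?S \<subseteq> B \<union> A" "B \<inter> A \<inter> ?S = {}" using AB by blast+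
      ultimately show False using key[OF AB(2,1) _ _ AB(5)] by blast
    qed
  qed
qed

theorem theorem1p3:
  fixes f :: "complex \<Rightarrow> complex" and \<alpha> :: complex
  assumes "transcendental_entire f"
    and "finite_log_asymptotic_value f \<alpha>"
    and "\<alpha> \<in> julia_set f"
  shows "connected (insert sphere_infinity (sphere_of ` bungee_set f))"
proof -
  obtain r U where r: "r > 0" and U: "U \<in> components (f -` ball \<alpha> r)"
    and cov: "covering_space U f (ball \<alpha> r - {\<alpha>})"
    using assms(2) unfolding finite_log_asymptotic_value_def by blast
  have "\<not> f constant_on UNIV"
  proof
    assume "f constant_on UNIV"
    then obtain c where "\<And>z. f z = c" unfolding constant_on_def by auto
    then have "\<forall>z. f z = poly [:c:] z" by simp
    then show False using assms(1) unfolding transcendental_entire_def by blast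
  qed
  then interpret log_tract f \<alpha> r U
    using assms r U covering_space_imp_surjective[OF cov] by unfold_locales (auto simp: transcendental_entire_def)
  show ?thesis using frontier_meets_bungee by (rule connected_insert_sphere_infinity)
qed

end
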